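(* Let $G$ be a locally compact Hausdorff topological group. Let $X, Y\in G\text{-}\mathcal{M}$, let $A$ be a closed $G$-subset of $X$ and let $f: A\rightarrow Y$ be a $G$-map. If $X$, $A$ and $Y$ are $G$-ANE's and the adjunction space $X\cup_f Y$ (with its canonical $G$-action) belongs to $G\text{-}\mathcal{M}$, then $X\cup_f Y$ is a $G$-ANE.
   Context: $G$ is a locally compact Hausdorff topological group with unity $e$. A $G$-space is a topological space $X$ with a continuous action $G\times X\to X$, $(g,x)\mapsto gx$ (so $g(hx)=(gh)x$, $ex=x$). A $G$-subset (invariant subset) of $X$ is a subset $S$ with $S=G(S)=\{gs: g\in G, s\in S\}$; it is a $G$-space with the restricted action. A $G$-neighborhood is a neighborhood that is a $G$-subset. A $G$-map is a continuous map $f$ between $G$-spaces with $f(gx)=gf(x)$ for all $g\in G$ and all $x$. Proper $G$-spaces (Palais): a subset $V\subseteq X$ is small if every point of $X$ has a neighborhood $U$ in $X$ such that $\{g\in G: gU\cap V\neq\emptyset\}$ has compact closure in $G$. $X$ is proper if it has an open cover consisting of small sets. $G\text{-}\mathcal{M}$ is the class of all metrizable proper $G$-spaces $X$ that admit a compatible $G$-invariant metric $d$, i.e. $d(gx,gy)=d(x,y)$ for all $x,y\in X$, $g\in G$. A $G$-space $Z$ is a $G$-ANE (absolute neighborhood extensor of $G\text{-}\mathcal{M}$) if for every $W\in G\text{-}\mathcal{M}$ and every closed $G$-subset $B$ of $W$, every $G$-map $B\to Z$ extends to a $G$-map $U\to Z$ on some $G$-neighborhood $U$ of $B$ in $W$.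 Adjunction space: $X\cup_f Y$ is the quotient space $(X\sqcup Y)/\sim$, where $\sim$ is the equivalence relation generated by the pairs $(a,f(a))$, $a\in A$. With $p: X\sqcup Y\to X\cup_f Y$ the quotient map, the canonical action of $G$ on $X\cup_f Y$ is the unique one with $g\,p(z)=p(gz)$ for all $g\in G$, $z\in X\sqcup Y$ (where $G$ acts on $X\sqcup Y$ via the given actions on $X$ and $Y$); it is continuous since $G$ is locally compact. *)

theory Defs
  imports "HOL-Analysis.Analysis" "HOL-Algebra.Group_Action"
begin

text \<open>
  A topological group is a group \<open>G\<close> in the sense of HOL-Algebra together with a topology \<open>T\<close> on
  its carrier. Spaces are abstract topologies, so that subspaces, disjoint unions and quotients
  are available as spaces.
\<close>

locale topological_group_on = group G for G (structure) +
  fixes T :: "'g topology"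
  assumes topspace_group: "topspace T = carrier G"
    and continuous_mult: "continuous_map (prod_topology T T) T (\<lambda>(g, h). g \<otimes> h)"
    and continuous_inv: "continuous_map T T (\<lambda>g. inv g)"

definition lc_Hausdorff_group :: "('g, 'm) monoid_scheme \<Rightarrow> 'g topology \<Rightarrow> bool" where
  "lc_Hausdorff_group G T \<longleftrightarrow>
     topological_group_on G T \<and> locally_compact_space T \<and> Hausdorff_space T"


section \<open>G-spaces\<close>

text \<open>
  The values of \<open>act\<close> outside \<open>carrier G \<times> topspace X\<close> are irrelevant. The library's
  \<open>group_action\<close> demands extensional functions, hence the restriction.
\<close>

definition G_space ::
    "('g, 'm) monoid_scheme \<Rightarrow> 'g topology \<Rightarrow> 'x topology \<Rightarrow> ('g \<Rightarrow> 'x \<Rightarrow> 'x) \<Rightarrow> bool" where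
  "G_space G T X act \<longleftrightarrow>
     group_action G (topspace X) (\<lambda>g. restrict (act g) (topspace X)) \<and>
     continuous_map (prod_topology T X) X (\<lambda>(g, x). act g x)"

definition G_subset ::
    "('g, 'm) monoid_scheme \<Rightarrow> 'x topology \<Rightarrow> ('g \<Rightarrow> 'x \<Rightarrow> 'x) \<Rightarrow> 'x set \<Rightarrow> bool" where
  "G_subset G X act S \<longleftrightarrow> S \<subseteq> topspace X \<and> S = {act g s | g s. g \<in> carrier G \<and> s \<in> S}"

definition nbhd_of :: "'x topology \<Rightarrow> 'x set \<Rightarrow> 'x set \<Rightarrow> bool" where
  "nbhd_of X S U \<longleftrightarrow> U \<subseteq> topspace X \<and> (\<exists>V. openin X V \<and> S \<subseteq> V \<and> V \<subseteq> U)"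

definition G_map ::
    "('g, 'm) monoid_scheme \<Rightarrow> 'x topology \<Rightarrow> ('g \<Rightarrow> 'x \<Rightarrow> 'x) \<Rightarrow>
     'y topology \<Rightarrow> ('g \<Rightarrow> 'y \<Rightarrow> 'y) \<Rightarrow> ('x \<Rightarrow> 'y) \<Rightarrow> bool" where
  "G_map G X actX Y actY f \<longleftrightarrow>
     continuous_map X Y f \<and> (\<forall>g\<in>carrier G. \<forall>x\<in>topspace X. f (actX g x) = actY g (f x))"

definition small_subset ::
    "('g, 'm) monoid_scheme \<Rightarrow> 'g topology \<Rightarrow> 'x topology \<Rightarrow> ('g \<Rightarrow> 'x \<Rightarrow> 'x) \<Rightarrow> 'x set \<Rightarrow> bool" where
  "small_subset G T X act V \<longleftrightarrow>
     V \<subseteq> topspace X \<and>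
     (\<forall>x\<in>topspace X. \<exists>U. nbhd_of X {x} U \<and>
        compactin T (T closure_of {g \<in> carrier G. act g ` U \<inter> V \<noteq> {}}))"

definition proper_G_space ::
    "('g, 'm) monoid_scheme \<Rightarrow> 'g topology \<Rightarrow> 'x topology \<Rightarrow> ('g \<Rightarrow> 'x \<Rightarrow> 'x) \<Rightarrow> bool" where
  "proper_G_space G T X act \<longleftrightarrow>
     G_space G T X act \<and>
     (\<exists>\<V>. (\<forall>V\<in>\<V>. openin X V \<and> small_subset G T X act V) \<and> \<Union>\<V> = topspace X)"

definition G_metrizable ::
    "('g, 'm) monoid_scheme \<Rightarrow> 'g topology \<Rightarrow> 'x topology \<Rightarrow> ('g \<Rightarrow> 'x \<Rightarrow> 'x) \<Rightarrow> bool" where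
  "G_metrizable G T X act \<longleftrightarrow>
     proper_G_space G T X act \<and>
     (\<exists>d. Metric_space (topspace X) d \<and> Metric_space.mtopology (topspace X) d = X \<and>
          (\<forall>g\<in>carrier G. \<forall>x\<in>topspace X. \<forall>y\<in>topspace X. d (act g x) (act g y) = d x y))"

text \<open>
  The test spaces \<open>W\<close> range over all members of the class \<open>G_metrizable\<close> whose points belong to the
  type \<open>'w\<close>; HOL cannot quantify over types inside a formula, so \<open>'w\<close> is a parameter. A theorem
  concluding \<open>G_ANE TYPE('w)\<close> for a type variable \<open>'w\<close> covers all test spaces. As a
  hypothesis, \<open>G_ANE TYPE('t)\<close> for a particular \<open>'t\<close> asks no more than the extension property for
  all test spaces; \<open>'t\<close> has to be large enough to contain the test spaces one needs, for instance
  copies of the given spaces and of their products with an interval.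
\<close>

definition G_ANE ::
    "'w itself \<Rightarrow> ('g, 'm) monoid_scheme \<Rightarrow> 'g topology \<Rightarrow>
     'z topology \<Rightarrow> ('g \<Rightarrow> 'z \<Rightarrow> 'z) \<Rightarrow> bool" where
  "G_ANE _ G T Z act \<longleftrightarrow>
     G_space G T Z act \<and>
     (\<forall>(W :: 'w topology) actW B \<phi>.
        G_metrizable G T W actW \<and> closedin W B \<and> G_subset G W actW B \<and>
        G_map G (subtopology W B) actW Z act \<phi> \<longrightarrow>
        (\<exists>U \<Phi>. nbhd_of W B U \<and> G_subset G W actW U \<and>
           G_map G (subtopology W U) actW Z act \<Phi> \<and> (\<forall>b\<in>B. \<Phi> b = \<phi> b)))"


section \<open>Adjunction spaces\<close>

definition disjoint_sum :: "'x topology \<Rightarrow> 'y topology \<Rightarrow> ('x + 'y) topology" where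
  "disjoint_sum X Y = topology (\<lambda>U. openin X (Inl -` U) \<and> openin Y (Inr -` U))"

definition adj_proj :: "'x set \<Rightarrow> ('x \<Rightarrow> 'y) \<Rightarrow> 'x + 'y \<Rightarrow> ('x + 'y) set" where
  "adj_proj A f z = {z'. equivclp (\<lambda>u v. \<exists>a\<in>A. u = Inl a \<and> v = Inr (f a)) z z'}"

definition adjunction_space ::
    "'x topology \<Rightarrow> 'x set \<Rightarrow> ('x \<Rightarrow> 'y) \<Rightarrow> 'y topology \<Rightarrow> ('x + 'y) set topology" where
  "adjunction_space X A f Y =
     topology (\<lambda>U. U \<subseteq> adj_proj A f ` topspace (disjoint_sum X Y) \<and>
       openin (disjoint_sum X Y) {z \<in> topspace (disjoint_sum X Y). adj_proj A f z \<in> U})"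

text \<open>Points of the adjunction space are equivalence classes; a group element acts on them by
  taking images. That this is the canonical action is lemma \<open>adj_act_adj_proj\<close> below.\<close>

definition adj_act ::
    "('g \<Rightarrow> 'x \<Rightarrow> 'x) \<Rightarrow> ('g \<Rightarrow> 'y \<Rightarrow> 'y) \<Rightarrow> 'g \<Rightarrow> ('x + 'y) set \<Rightarrow> ('x + 'y) set" where
  "adj_act actX actY g C = map_sum (actX g) (actY g) ` C"


section \<open>Basic properties of the definitions\<close>

lemma G_space_iff:
  assumes "group G"
  shows "G_space G T X act \<longleftrightarrow>
     continuous_map (prod_topology T X) X (\<lambda>(g, x). act g x) \<and>
     (\<forall>g\<in>carrier G. \<forall>x\<in>topspace X. act g x \<in> topspace X) \<and>
     (\<forall>x\<in>topspace X. act \<one>\<^bsub>G\<^esub> x = x) \<and>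
     (\<forall>g\<in>carrier G. \<forall>h\<in>carrier G. \<forall>x\<in>topspace X. act g (act h x) = act (g \<otimes>\<^bsub>G\<^esub> h) x)"
    (is "?L \<longleftrightarrow> ?C \<and> ?R")
proof -
  interpret group G by fact
  let ?E = "topspace X"
  let ?r = "\<lambda>g. restrict (act g) ?E"
  have "group_action G ?E ?r" if R: ?R
  proof -
    have bij: "bij_betw (act g) ?E ?E" if g: "g \<in> carrier G" for g
    proof (rule bij_betw_byWitness[where f' = "act (inv\<^bsub>G\<^esub> g)"])
      show "\<forall>a\<in>?E. act (inv\<^bsub>G\<^esub> g) (act g a) = a" "\<forall>a\<in>?E. act g (act (inv\<^bsub>G\<^esub> g) a) = a"
        using R g by auto
    qed (use R g in auto)
    have "?r \<in> hom G (BijGroup ?E)"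
    proof (rule homI)
      fix g h assume g: "g \<in> carrier G" and h: "h \<in> carrier G"
      have B: "?r g \<in> Bij ?E" "?r h \<in> Bij ?E"
        using bij[OF g] bij[OF h] by (auto simp: Bij_def cong: bij_betw_cong)
      have "?r (g \<otimes>\<^bsub>G\<^esub> h) = compose ?E (?r g) (?r h)"
      proof
        fix x show "?r (g \<otimes>\<^bsub>G\<^esub> h) x = compose ?E (?r g) (?r h) x"
          using R g h by (cases "x \<in> ?E") (simp_all add: compose_def)
      qed
      then show "?r (g \<otimes>\<^bsub>G\<^esub> h) = ?r g \<otimes>\<^bsub>BijGroup ?E\<^esub> ?r h"
        using B by (simp add: BijGroup_def)
    next
      fix g assume "g \<in> carrier G"
      from bij[OF this] show "?r g \<in> carrier (BijGroup ?E)"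
        by (simp add: Bij_def BijGroup_def cong: bij_betw_cong)
    qed
    then show ?thesis
      by (simp add: group_action_def group_hom_def group_hom_axioms_def group_BijGroup
          group_axioms)
  qed
  moreover have ?R if "group_action G ?E ?r"
  proof -
    interpret group_action G ?E ?r by fact
    have 1: "act g x \<in> ?E" if "g \<in> carrier G" "x \<in> ?E" for g x
      using element_image[OF that refl] that(2) by simp
    have 2: "act \<one>\<^bsub>G\<^esub> x = x" if "x \<in> ?E" for x
      using fun_cong[OF id_eq_one, of x] that by simp
    have 3: "act g (act h x) = act (g \<otimes>\<^bsub>G\<^esub> h) x"
      if "g \<in> carrier G" "h \<in> carrier G" "x \<in> ?E" for g h x
      using composition_rule[OF that(3,1,2)] 1[OF that(2,3)] that(3) by simp
    show ?thesis using 1 2 3 by blast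
  qed
  ultimately show ?thesis
    unfolding G_space_def by blast
qed

lemma openin_disjoint_sum:
  "openin (disjoint_sum X Y) U \<longleftrightarrow> openin X (Inl -` U) \<and> openin Y (Inr -` U)"
proof -
  have "istopology (\<lambda>U. openin X (Inl -` U) \<and> openin Y (Inr -` U))"
    unfolding istopology_def by (auto simp: vimage_Union)
  then show ?thesis
    by (simp add: disjoint_sum_def topology_inverse')
qed

lemma topspace_disjoint_sum:
  "topspace (disjoint_sum X Y) = Inl ` topspace X \<union> Inr ` topspace Y"
proof (rule subset_antisym)
  have *: "Inl -` (Inl ` S \<union> Inr ` R) = S" "Inr -` (Inl ` S \<union> Inr ` R) = R"
    for S :: "'a set" and R :: "'b set" by auto
  show "Inl ` topspace X \<union> Inr ` topspace Y \<subseteq> topspace (disjoint_sum X Y)"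
    by (rule openin_subset) (simp only: openin_disjoint_sum * openin_topspace simp_thms)
  show "topspace (disjoint_sum X Y) \<subseteq> Inl ` topspace X \<union> Inr ` topspace Y"
  proof
    fix z assume z: "z \<in> topspace (disjoint_sum X Y)"
    have "openin X (Inl -` topspace (disjoint_sum X Y))"
         "openin Y (Inr -` topspace (disjoint_sum X Y))"
      using openin_disjoint_sum openin_topspace by blast+
    then show "z \<in> Inl ` topspace X \<union> Inr ` topspace Y"
      using z by (cases z) (auto dest!: openin_subset)
  qed
qed

lemma openin_adjunction_space:
  "openin (adjunction_space X A f Y) U \<longleftrightarrow>
     U \<subseteq> adj_proj A f ` topspace (disjoint_sum X Y) \<and>
     openin (disjoint_sum X Y) {z \<in> topspace (disjoint_sum X Y). adj_proj A f z \<in> U}"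
proof -
  let ?S = "disjoint_sum X Y" and ?p = "adj_proj A f"
  have 1: "{z \<in> topspace ?S. ?p z \<in> U \<inter> V} =
      {z \<in> topspace ?S. ?p z \<in> U} \<inter> {z \<in> topspace ?S. ?p z \<in> V}" for U V by auto
  have 2: "{z \<in> topspace ?S. ?p z \<in> \<Union>\<K>} = (\<Union>U\<in>\<K>. {z \<in> topspace ?S. ?p z \<in> U})" for \<K>
    by auto
  have "istopology (\<lambda>U. U \<subseteq> ?p ` topspace ?S \<and> openin ?S {z \<in> topspace ?S. ?p z \<in> U})"
    unfolding istopology_def 1 2 by blast
  then show ?thesis
    by (simp add: adjunction_space_def topology_inverse')
qed

lemma topspace_adjunction_space:
  "topspace (adjunction_space X A f Y) = adj_proj A f ` topspace (disjoint_sum X Y)"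
proof (rule subset_antisym)
  show "topspace (adjunction_space X A f Y) \<subseteq> adj_proj A f ` topspace (disjoint_sum X Y)"
    using openin_adjunction_space openin_topspace by blast
  have *: "{z \<in> topspace (disjoint_sum X Y). adj_proj A f z \<in>
       adj_proj A f ` topspace (disjoint_sum X Y)} = topspace (disjoint_sum X Y)" by auto
  show "adj_proj A f ` topspace (disjoint_sum X Y) \<subseteq> topspace (adjunction_space X A f Y)"
    by (rule openin_subset) (simp add: openin_adjunction_space *)
qed

lemma quotient_map_adj_proj:
  "quotient_map (disjoint_sum X Y) (adjunction_space X A f Y) (adj_proj A f)"
  by (auto simp: quotient_map_def topspace_adjunction_space openin_adjunction_space)

lemma adj_act_adj_proj:
  assumes G: "group G" and X: "G_space G T X actX" and Y: "G_space G T Y actY"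
    and A: "G_subset G X actX A" and f: "G_map G (subtopology X A) actX Y actY f"
    and g: "g \<in> carrier G" and z: "z \<in> topspace (disjoint_sum X Y)"
  shows "adj_act actX actY g (adj_proj A f z) = adj_proj A f (map_sum (actX g) (actY g) z)"
proof -
  interpret group G by fact
  let ?S = "topspace (disjoint_sum X Y)"
  let ?R = "\<lambda>u v. \<exists>a\<in>A. u = Inl a \<and> v = Inr (f a)"
  let ?m = "\<lambda>g. map_sum (actX g) (actY g)"
  have X1: "actX h x \<in> topspace X" and X2: "actX \<one>\<^bsub>G\<^esub> x = x"
    and X3: "k \<in> carrier G \<Longrightarrow> actX k (actX h x) = actX (k \<otimes>\<^bsub>G\<^esub> h) x"
    if "h \<in> carrier G" "x \<in> topspace X" for h k x
    using X that by (simp_all add: G_space_iff[OF G])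
  have Y1: "actY h y \<in> topspace Y" and Y2: "actY \<one>\<^bsub>G\<^esub> y = y"
    and Y3: "k \<in> carrier G \<Longrightarrow> actY k (actY h y) = actY (k \<otimes>\<^bsub>G\<^esub> h) y"
    if "h \<in> carrier G" "y \<in> topspace Y" for h k y
    using Y that by (simp_all add: G_space_iff[OF G])
  have AX: "A \<subseteq> topspace X" using A by (simp add: G_subset_def)
  have fY: "f a \<in> topspace Y" if "a \<in> A" for a
    using f AX that by (auto simp: G_map_def continuous_map_def Pi_iff)
  have Rm: "?R (?m h u) (?m h v)" if "h \<in> carrier G" "?R u v" for h u v
  proof -
    obtain a where a: "a \<in> A" "u = Inl a" "v = Inr (f a)" using \<open>?R u v\<close> by blast
    have "actX h a \<in> A" using A a(1) that(1) unfolding G_subset_def by blast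
    moreover have "f (actX h a) = actY h (f a)"
      using f a(1) AX that(1) by (auto simp: G_map_def)
    ultimately show ?thesis using a by auto
  qed
  have step: "equivclp ?R (?m h u) (?m h v)" if "equivclp ?R u v" "h \<in> carrier G" for h u v
    using that(1)
  proof (induction rule: equivclp_induct)
    case base show ?case by simp
  next
    case (step v w)
    have "?R (?m h v) (?m h w) \<or> ?R (?m h w) (?m h v)"
      using step.hyps(2) Rm[OF that(2), of v w] Rm[OF that(2), of w v] by argo
    with step.IH show ?case by (rule equivclp_into_equivclp)
  qed
  have inS: "v \<in> ?S" if "equivclp ?R u v" "u \<in> ?S" for u v
    using that
  proof (induction rule: equivclp_induct)
    case (step v w)
    then show ?case using AX fY by (auto simp: topspace_disjoint_sum)
  qed
  have mS: "?m h u \<in> ?S" if "h \<in> carrier G" "u \<in> ?S" for h u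
    using that X1 Y1 by (auto simp: topspace_disjoint_sum)
  have inv1: "?m (inv\<^bsub>G\<^esub> g) (?m g u) = u" and inv2: "?m g (?m (inv\<^bsub>G\<^esub> g) u) = u" if "u \<in> ?S" for u
    using that g by (auto simp: topspace_disjoint_sum X2[OF g] X3 Y2[OF g] Y3)
  show ?thesis
  proof (intro subset_antisym subsetI)
    fix w assume "w \<in> adj_act actX actY g (adj_proj A f z)"
    then show "w \<in> adj_proj A f (?m g z)"
      using step g by (auto simp: adj_act_def adj_proj_def)
  next
    fix w assume "w \<in> adj_proj A f (?m g z)"
    then have w: "equivclp ?R (?m g z) w" by (simp add: adj_proj_def)
    then have "equivclp ?R z (?m (inv\<^bsub>G\<^esub> g) w)"
      using step[OF w, of "inv\<^bsub>G\<^esub> g"] g inv1[OF z] by simp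
    moreover have "w = ?m g (?m (inv\<^bsub>G\<^esub> g) w)"
      using inv2 inS[OF w mS[OF g z]] by simp
    ultimately show "w \<in> adj_act actX actY g (adj_proj A f z)"
      unfolding adj_act_def adj_proj_def by blast
  qed
qed

end

theory Submission
  imports Defs
begin

text \<open>
  Since \<open>A\<close> is a neighbourhood retract of \<open>X\<close> and \<open>X\<close> is a \<open>G\<close>-ANE, there is a \<open>G\<close>-homotopy \<open>H\<close> of
  \<open>X\<close> rel \<open>A\<close>, starting at the identity, that ends by pushing a neighbourhood of \<open>A\<close> into \<open>A\<close>.

  Given \<open>\<phi> : B \<rightarrow> Z\<close> on a closed invariant \<open>B \<subseteq> W\<close>, let \<open>BY\<close> be the preimage of the copy of \<open>Y\<close>
  in \<open>Z = X \<union>\<^sub>f Y\<close>. Outside \<open>BY\<close> the map \<open>\<phi>\<close> lifts to \<open>X\<close> and extends to a map \<open>\<xi>\<close> on a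
  neighbourhood of \<open>B - BY\<close> in \<open>W - BY\<close>. Over a relatively closed neighbourhood \<open>F\<close> of \<open>B - BY\<close> in
  \<open>W - BY\<close>, so thin that \<open>\<xi>\<close> stays close to \<open>\<phi>\<close> near \<open>BY\<close>, every map \<open>w \<mapsto> H (\<xi> w) (s w)\<close> extends
  continuously by \<open>\<phi>\<close> to \<open>F \<union> BY\<close>. At time \<open>s = 1\<close> it takes values in \<open>Y\<close> near \<open>BY\<close>, so it extends
  to a map \<open>\<psi>\<close> into \<open>Y\<close> on a neighbourhood of the part where it does. Letting \<open>s\<close> run from \<open>0\<close> on
  \<open>B\<close> to \<open>1\<close> on the frontier of \<open>F\<close> interpolates between \<open>\<phi>\<close> and \<open>\<psi>\<close>. Invariant metrics on \<open>W\<close>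
  and \<open>Z\<close> allow all these neighbourhoods to be chosen invariant.
\<close>

section \<open>Topological preliminaries\<close>

lemma continuous_map_paste_closed:
  assumes "closedin X S" "closedin X R" "topspace X \<subseteq> S \<union> R"
    and "continuous_map (subtopology X S) Y f" "continuous_map (subtopology X R) Y g"
    and "\<And>x. x \<in> S \<Longrightarrow> x \<in> R \<Longrightarrow> f x = g x"
  shows "continuous_map X Y (\<lambda>x. if x \<in> S then f x else g x)"
proof (rule pasting_lemma_closed[where I = "UNIV :: bool set" and T = "\<lambda>b. if b then S else R"
      and f = "\<lambda>b. if b then f else g"])
  fix x assume "x \<in> topspace X"
  then show "\<exists>j. j \<in> UNIV \<and> x \<in> (if j then S else R) \<and>
      (if x \<in> S then f x else g x) = (if j then f else g) x"
    using assms(3) by (intro exI[of _ "x \<in> S"]) auto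
qed (use assms in \<open>auto split: if_splits\<close>)

lemma mtopology_pullback:
  assumes M: "Metric_space M d" and e: "inj_on e S" "e ` S \<subseteq> M"
  shows "Metric_space S (\<lambda>x y. d (e x) (e y))"
    and "Metric_space.mtopology S (\<lambda>x y. d (e x) (e y))
       = pullback_topology S e (Metric_space.mtopology M d)"
proof -
  interpret M: Metric_space M d by fact
  show S: "Metric_space S (\<lambda>x y. d (e x) (e y))"
    using e by unfold_locales (auto simp: M.commute inj_on_def image_subset_iff intro!: M.triangle)
  then interpret S: Metric_space S "\<lambda>x y. d (e x) (e y)" .
  show "S.mtopology = pullback_topology S e M.mtopology"
  proof (rule topology_eq[THEN iffD2], intro allI iffI)
    fix U assume U: "openin S.mtopology U"
    \<comment> \<open>Collecting every target ball whose trace lies in \<open>U\<close> gives an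
      open set of \<open>M\<close> with trace exactly \<open>U\<close>, without choosing a radius
      for each point.\<close>
    define V where "V = \<Union>{M.mball (e x) r |x r. x \<in> U \<and> S.mball x r \<subseteq> U}"
    have "openin M.mtopology V" unfolding V_def by auto
    moreover have "U = e -` V \<inter> S"
    proof (intro subset_antisym subsetI)
      fix x assume x: "x \<in> U"
      then obtain r where "r > 0" "S.mball x r \<subseteq> U" using U S.openin_mtopology by blast
      moreover have "x \<in> S" using U x S.openin_mtopology by blast
      ultimately show "x \<in> e -` V \<inter> S"
        unfolding V_def using x e by (auto intro!: exI[of _ "M.mball (e x) r"])
    next
      fix x assume "x \<in> e -` V \<inter> S"
      then obtain y r where "y \<in> U" "S.mball y r \<subseteq> U" "e x \<in> M.mball (e y) r" "x \<in> S"
        unfolding V_def by blast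
      moreover have "y \<in> S" using U \<open>y \<in> U\<close> S.openin_mtopology by blast
      ultimately show "x \<in> U" by (auto simp: subset_iff)
    qed
    ultimately show "openin (pullback_topology S e M.mtopology) U"
      unfolding openin_pullback_topology by blast
  next
    fix U assume "openin (pullback_topology S e M.mtopology) U"
    then obtain V where V: "openin M.mtopology V" "U = e -` V \<inter> S"
      unfolding openin_pullback_topology by blast
    show "openin S.mtopology U"
      unfolding S.openin_mtopology
    proof (intro conjI allI impI)
      show "U \<subseteq> S" using V by blast
      fix x assume "x \<in> U"
      then obtain r where r: "r > 0" "M.mball (e x) r \<subseteq> V" "x \<in> S"
        using V M.openin_mtopology by blast
      have "S.mball x r \<subseteq> U"
        using r e unfolding V(2) by (auto simp: subset_iff)
      with r show "\<exists>r>0. S.mball x r \<subseteq> U" by blast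
    qed
  qed
qed

lemma (in Metric_space) continuous_map_dist_point:
  assumes "b \<in> M"
  shows "continuous_map mtopology euclideanreal (\<lambda>x. d x b)"
  unfolding continuous_map_from_metric
proof (intro conjI ballI allI impI)
  fix a U assume a: "a \<in> M" and U: "openin euclideanreal U \<and> d a b \<in> U"
  then obtain r where r: "r > 0" "ball (d a b) r \<subseteq> U"
    by (metis open_contains_ball open_openin)
  have "d x b \<in> U" if "x \<in> M" "d a x < r" for x
    using triangle[OF a that(1) assms] triangle[OF that(1) a assms] that(2) r(2)
    by (auto simp: commute subset_iff dist_real_def abs_if)
  with r show "\<exists>r>0. \<forall>x. x \<in> M \<and> d a x < r \<longrightarrow> d x b \<in> U" by blast
qed simp

section \<open>Invariant metrics and extension of G-maps\<close>

context group
begin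

section \<open>Elementary facts on actions and invariant neighbourhoods\<close>

lemma G_space_act:
  assumes "G_space G T X act"
  shows "\<lbrakk>g \<in> carrier G; x \<in> topspace X\<rbrakk> \<Longrightarrow> act g x \<in> topspace X"
    and "x \<in> topspace X \<Longrightarrow> act \<one> x = x"
    and "\<lbrakk>g \<in> carrier G; h \<in> carrier G; x \<in> topspace X\<rbrakk> \<Longrightarrow> act g (act h x) = act (g \<otimes> h) x"
    and "\<lbrakk>g \<in> carrier G; x \<in> topspace X\<rbrakk> \<Longrightarrow> act (inv g) (act g x) = x"
  using assms by (auto simp: G_space_iff[OF is_group])

text \<open>Closure under the action suffices, since the unit fixes every point and so puts
  \<open>S\<close> inside its set of translates.\<close>

lemma G_subset_iff:
  assumes "G_space G T X act"
  shows "G_subset G X act S \<longleftrightarrow> S \<subseteq> topspace X \<and> (\<forall>g\<in>carrier G. \<forall>s\<in>S. act g s \<in> S)"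
    (is "?L \<longleftrightarrow> ?R")
proof
  assume ?L then show ?R unfolding G_subset_def by blast
next
  assume R: ?R
  have "s \<in> {act g s |g s. g \<in> carrier G \<and> s \<in> S}" if "s \<in> S" for s
  proof -
    have "act \<one> s = s" using R that G_space_act(2)[OF assms] by blast
    with that show ?thesis by (metis (mono_tags, lifting) mem_Collect_eq one_closed)
  qed
  then show ?L unfolding G_subset_def using R by blast
qed

lemma G_subset_act_iff:
  assumes "G_space G T X act" "G_subset G X act S" "g \<in> carrier G" "x \<in> topspace X"
  shows "act g x \<in> S \<longleftrightarrow> x \<in> S"
  using assms(2-4) G_subset_iff[OF assms(1)] G_space_act(4)[OF assms(1)] by (metis inv_closed)

lemma continuous_map_act:
  assumes X: "G_space G T X act" and T: "topspace T = carrier G" and g: "g \<in> carrier G"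
  shows "continuous_map X X (act g)"
proof -
  have "continuous_map X (prod_topology T X) (\<lambda>x. (g, x))"
    using g T by (intro continuous_map_pairedI) auto
  from continuous_map_compose[OF this, of X "\<lambda>(g, x). act g x"] show ?thesis
    using X by (simp add: G_space_def o_def)
qed

text \<open>The union of all translates of an open set between \<open>B\<close> and \<open>U\<close>
  is open and invariant, and it stays inside \<open>U\<close> because \<open>U\<close> is
  invariant.\<close>

lemma open_G_nbhd:
  assumes X: "G_space G T X act" and T: "topspace T = carrier G"
    and U: "nbhd_of X B U" "G_subset G X act U"
  obtains V where "openin X V" "B \<subseteq> V" "V \<subseteq> U" "G_subset G X act V"
proof -
  obtain V0 where V0: "openin X V0" "B \<subseteq> V0" "V0 \<subseteq> U"
    using U(1) unfolding nbhd_of_def by blast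
  \<comment> \<open>Preimages under \<open>act g\<close> replace images: as \<open>g\<close> runs
    through the group they give the same translates, and they are open by continuity alone.\<close>
  define V where "V = (\<Union>g\<in>carrier G. {x \<in> topspace X. act g x \<in> V0})"
  have "openin X V"
    unfolding V_def using continuous_map_act[OF X T] V0(1)
    by (auto intro!: openin_continuous_map_preimage)
  moreover have "B \<subseteq> V"
  proof
    fix b assume "b \<in> B"
    then have "b \<in> V0" "b \<in> topspace X" using V0 openin_subset by blast+
    then show "b \<in> V" unfolding V_def using G_space_act(2)[OF X] by force
  qed
  moreover have "V \<subseteq> U"
  proof
    fix x assume "x \<in> V"
    then obtain g where g: "g \<in> carrier G" "x \<in> topspace X" "act g x \<in> U"
      unfolding V_def using V0 by blast
    then have "act (inv g) (act g x) \<in> U"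
      using U(2) G_subset_iff[OF X] inv_closed by blast
    then show "x \<in> U" using G_space_act(4)[OF X] g by simp
  qed
  moreover have "G_subset G X act V"
    unfolding G_subset_iff[OF X]
  proof (intro conjI ballI)
    show "V \<subseteq> topspace X" unfolding V_def by blast
    fix g x assume g: "g \<in> carrier G" and "x \<in> V"
    then obtain h where h: "h \<in> carrier G" "x \<in> topspace X" "act h x \<in> V0"
      unfolding V_def by blast
    have "act (h \<otimes> inv g) (act g x) = act h x"
      using g h G_space_act(3,4)[OF X] G_space_act(1)[OF X]
      by (metis inv_closed)
    then show "act g x \<in> V"
      unfolding V_def using g h G_space_act(1)[OF X] by (intro UN_I[of "h \<otimes> inv g"]) auto
  qed
  ultimately show ?thesis using that by blast
qed

lemma nbhd_of_open: "openin X V \<Longrightarrow> B \<subseteq> V \<Longrightarrow> nbhd_of X B V"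
  unfolding nbhd_of_def using openin_subset by blast

text \<open>The neighbourhood in the definition of a G-ANE need not be open. Cutting it down to an
  open invariant one makes restrictions and later gluing easy.\<close>

lemma G_ANE_extend:
  assumes Z: "G_ANE TYPE('w) G T Z act" and T: "topspace T = carrier G"
    and W: "G_metrizable G T (W :: 'w topology) actW"
    and B: "closedin W B" "G_subset G W actW B" "G_map G (subtopology W B) actW Z act \<phi>"
  obtains V \<Phi> where "openin W V" "B \<subseteq> V" "G_subset G W actW V"
    "G_map G (subtopology W V) actW Z act \<Phi>" "\<forall>b\<in>B. \<Phi> b = \<phi> b"
proof -
  obtain U \<Phi> where U: "nbhd_of W B U" "G_subset G W actW U"
    "G_map G (subtopology W U) actW Z act \<Phi>" "\<forall>b\<in>B. \<Phi> b = \<phi> b"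
    using Z W B unfolding G_ANE_def by blast
  have "G_space G T W actW" using W by (simp add: G_metrizable_def proper_G_space_def)
  from open_G_nbhd[OF this T U(1,2)] obtain V where
    V: "openin W V" "B \<subseteq> V" "V \<subseteq> U" "G_subset G W actW V" by blast
  have "G_map G (subtopology W V) actW Z act \<Phi>"
    using U(3) V(3) unfolding G_map_def
    by (auto intro: continuous_map_from_subtopology_mono)
  with U V that show ?thesis by blast
qed

section \<open>Stability of the class of test spaces\<close>

lemma G_metrizable_G_space: "G_metrizable G T X act \<Longrightarrow> G_space G T X act"
  by (simp add: G_metrizable_def proper_G_space_def)

lemma small_subset_nbhd:
  assumes "small_subset G T X act V" and x: "x \<in> topspace X"
  obtains U V0 where "U \<subseteq> topspace X" "openin X V0" "x \<in> V0" "V0 \<subseteq> U"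
    "compactin T (T closure_of {g \<in> carrier G. act g ` U \<inter> V \<noteq> {}})"
proof -
  obtain U where U: "nbhd_of X {x} U"
    and c: "compactin T (T closure_of {g \<in> carrier G. act g ` U \<inter> V \<noteq> {}})"
    using assms unfolding small_subset_def by (elim conjE) (drule (1) bspec, elim exE conjE)
  then obtain V0 where "U \<subseteq> topspace X" "openin X V0" "{x} \<subseteq> V0" "V0 \<subseteq> U"
    unfolding nbhd_of_def by (elim exE conjE)
  with c that[of U V0] show ?thesis by simp
qed

lemma G_metrizable_small_cover:
  assumes "G_metrizable G T X act"
  obtains \<V> where "\<forall>V\<in>\<V>. openin X V \<and> small_subset G T X act V" "\<Union>\<V> = topspace X"
proof -
  have "proper_G_space G T X act" using assms by (simp add: G_metrizable_def)
  then have "\<exists>\<V>. (\<forall>V\<in>\<V>. openin X V \<and> small_subset G T X act V) \<and> \<Union>\<V> = topspace X"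
    by (simp add: proper_G_space_def)
  then show ?thesis by (elim exE conjE) (rule that)
qed

lemma G_metrizable_metric:
  assumes "G_metrizable G T X act"
  obtains d where "Metric_space (topspace X) d" "Metric_space.mtopology (topspace X) d = X"
    "\<forall>g\<in>carrier G. \<forall>x\<in>topspace X. \<forall>y\<in>topspace X. d (act g x) (act g y) = d x y"
  using assms unfolding G_metrizable_def by (elim exE conjE) (rule that)

text \<open>This covers two cases at once: an invariant subspace, with \<open>e\<close> the
  identity, and a copy of \<open>W\<close> in another type, with \<open>e\<close> the inverse of the
  copying map. Action laws, small sets and metric are all pulled back along the equivariant
  injection \<open>e\<close>.\<close>

lemma G_metrizable_pullback:
  assumes T: "topspace T = carrier G" and W: "G_metrizable G T W act"
    and e: "inj_on e S" "e ` S \<subseteq> topspace W"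
    and act': "\<And>g x. g \<in> carrier G \<Longrightarrow> x \<in> S \<Longrightarrow> act' g x \<in> S \<and> e (act' g x) = act g (e x)"
  shows "G_metrizable G T (pullback_topology S e W) act'"
proof -
  let ?P = "pullback_topology S e W"
  have GW: "G_space G T W act" using W by (rule G_metrizable_G_space)
  have top: "topspace ?P = S" using e by (auto simp: topspace_pullback_topology)
  have ce: "continuous_map ?P W e"
    using continuous_map_pullback[of W W id S e] by simp
  have eS: "e x \<in> topspace W" if "x \<in> S" for x using e that by blast
  have gs: "G_space G T ?P act'"
    unfolding G_space_iff[OF is_group]
  proof (intro conjI ballI)
    \<comment> \<open>Continuity into a pullback topology can be tested after composing with
      \<open>e\<close>, and there \<open>act'\<close> turns into \<open>act\<close>.\<close>
    have "continuous_map (prod_topology T ?P) (prod_topology T W) (\<lambda>p. (fst p, (e \<circ> snd) p))"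
      by (intro continuous_map_pairedI continuous_map_fst continuous_map_compose[OF continuous_map_snd ce])
    then have "continuous_map (prod_topology T ?P) W ((\<lambda>(g, x). act g x) \<circ> (\<lambda>p. (fst p, (e \<circ> snd) p)))"
      using GW by (rule_tac continuous_map_compose) (auto simp: G_space_def)
    then have "continuous_map (prod_topology T ?P) W (e \<circ> (\<lambda>(g, x). act' g x))"
      by (rule continuous_map_eq) (auto simp: top T act')
    then show "continuous_map (prod_topology T ?P) ?P (\<lambda>(g, x). act' g x)"
      by (rule continuous_map_pullback') (auto simp: top T act')
  next
    fix x assume x: "x \<in> topspace ?P"
    then have "e (act' \<one> x) = e x" using act' G_space_act(2)[OF GW] eS top by simp
    then show "act' \<one> x = x" using e(1) x act' top by (auto simp: inj_on_def)
  next
    fix g h x assume g: "g \<in> carrier G" and h: "h \<in> carrier G" and x: "x \<in> topspace ?P"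
    show "act' g x \<in> topspace ?P" using g x act' top by auto
    have "e (act' g (act' h x)) = e (act' (g \<otimes> h) x)"
      using g h x act' top G_space_act(3)[OF GW] eS by simp
    then show "act' g (act' h x) = act' (g \<otimes> h) x"
      using e(1) g h x act' top by (auto simp: inj_on_def)
  qed
  obtain \<V> where \<V>: "\<forall>V\<in>\<V>. openin W V \<and> small_subset G T W act V" "\<Union>\<V> = topspace W"
    by (rule G_metrizable_small_cover[OF W])
  have small: "small_subset G T ?P act' (e -` V \<inter> S)" if V: "small_subset G T W act V" for V
    unfolding small_subset_def top
  proof (intro conjI ballI)
    fix x assume x: "x \<in> S"
    obtain U V0 where U: "U \<subseteq> topspace W" "openin W V0" "e x \<in> V0" "V0 \<subseteq> U"
      and c: "compactin T (T closure_of {g \<in> carrier G. act g ` U \<inter> V \<noteq> {}})"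
      by (rule small_subset_nbhd[OF V eS[OF x]])
    have "nbhd_of ?P {x} (e -` U \<inter> S)"
      unfolding nbhd_of_def top
    proof (intro conjI exI[of _ "e -` V0 \<inter> S"])
      show "openin ?P (e -` V0 \<inter> S)" unfolding openin_pullback_topology using U by blast
    qed (use U x in auto)
    \<comment> \<open>A group element that moves the preimage of \<open>U\<close> into contact with
      that of \<open>V\<close> does the same for \<open>U\<close> and \<open>V\<close>. The new
      closure is therefore a closed subset of a compact set.\<close>
    moreover have "{g \<in> carrier G. act' g ` (e -` U \<inter> S) \<inter> (e -` V \<inter> S) \<noteq> {}}
        \<subseteq> {g \<in> carrier G. act g ` U \<inter> V \<noteq> {}}"
    proof (intro subsetI CollectI conjI)
      fix g assume "g \<in> {g \<in> carrier G. act' g ` (e -` U \<inter> S) \<inter> (e -` V \<inter> S) \<noteq> {}}"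
      then obtain y where g: "g \<in> carrier G" and y: "e y \<in> U" "y \<in> S" "e (act' g y) \<in> V"
        by blast
      then have "e (act' g y) \<in> act g ` U" using act'[OF g y(2)] by simp
      with y show "act g ` U \<inter> V \<noteq> {}" by blast
      show "g \<in> carrier G" by fact
    qed
    then have "compactin T (T closure_of {g \<in> carrier G. act' g ` (e -` U \<inter> S) \<inter> (e -` V \<inter> S) \<noteq> {}})"
      by (intro closed_compactin[OF c closure_of_mono]) auto
    ultimately show "\<exists>U. nbhd_of ?P {x} U \<and>
        compactin T (T closure_of {g \<in> carrier G. act' g ` U \<inter> (e -` V \<inter> S) \<noteq> {}})" by blast
  qed auto
  have "proper_G_space G T ?P act'"
    unfolding proper_G_space_def
  proof (intro conjI exI[of _ "(\<lambda>V. e -` V \<inter> S) ` \<V>"] ballI gs)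
    have "\<Union>((\<lambda>V. e -` V \<inter> S) ` \<V>) = e -` \<Union>\<V> \<inter> S" by auto
    then show "\<Union>((\<lambda>V. e -` V \<inter> S) ` \<V>) = topspace ?P"
      by (simp only: \<V>(2) topspace_pullback_topology)
    fix V assume "V \<in> (\<lambda>V. e -` V \<inter> S) ` \<V>"
    then obtain V' where V': "V' \<in> \<V>" "V = e -` V' \<inter> S" by blast
    then have "openin W V'" "small_subset G T W act V'" using \<V>(1) by simp_all
    then show "openin ?P V" "small_subset G T ?P act' V"
      using V'(2) small by (auto simp: openin_pullback_topology)
  qed
  moreover obtain d where d: "Metric_space (topspace W) d"
    "Metric_space.mtopology (topspace W) d = W"
    "\<forall>g\<in>carrier G. \<forall>x\<in>topspace W. \<forall>y\<in>topspace W. d (act g x) (act g y) = d x y"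
    by (rule G_metrizable_metric[OF W])
  then have "\<exists>d'. Metric_space S d' \<and> Metric_space.mtopology S d' = ?P \<and>
       (\<forall>g\<in>carrier G. \<forall>x\<in>S. \<forall>y\<in>S. d' (act' g x) (act' g y) = d' x y)"
    using mtopology_pullback[OF d(1) e] act' eS
    by (intro exI[of _ "\<lambda>x y. d (e x) (e y)"]) simp
  ultimately show ?thesis unfolding G_metrizable_def top by blast
qed

lemma G_metrizable_subtopology:
  assumes "topspace T = carrier G" and W: "G_metrizable G T W act" and S: "G_subset G W act S"
  shows "G_metrizable G T (subtopology W S) act"
proof -
  have "subtopology W S = pullback_topology S id W"
    by (auto simp: topology_eq openin_subtopology openin_pullback_topology)
  moreover have "S \<subseteq> topspace W" "\<And>g x. g \<in> carrier G \<Longrightarrow> x \<in> S \<Longrightarrow> act g x \<in> S"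
    using S G_subset_iff[OF G_metrizable_G_space[OF W]] by blast+
  ultimately show ?thesis
    using G_metrizable_pullback[OF assms(1) W, of id S act] by simp
qed

text \<open>The group does not move the interval coordinate, so multiplying both sets by the whole
  interval adds no group elements to the sets that smallness restricts, and the product metric stays
  invariant.\<close>

lemma G_metrizable_prod_interval:
  assumes T: "topspace T = carrier G" and W: "G_metrizable G T W act"
  shows "G_metrizable G T (prod_topology W (top_of_set {0..1::real})) (\<lambda>g (x, t). (act g x, t))"
proof -
  let ?I = "top_of_set {0..1::real}"
  let ?P = "prod_topology W ?I" and ?a = "\<lambda>g (x, t). (act g x, t)"
  have GW: "G_space G T W act" using W by (rule G_metrizable_G_space)
  have gs: "G_space G T ?P ?a"
    unfolding G_space_iff[OF is_group]
  proof (intro conjI ballI)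
    let ?Q = "prod_topology T ?P"
    have 1: "continuous_map ?Q (prod_topology T W) (\<lambda>p. (fst p, (fst \<circ> snd) p))"
      by (intro continuous_map_pairedI continuous_map_fst
          continuous_map_compose[OF continuous_map_snd continuous_map_fst])
    have "continuous_map ?Q ?P (\<lambda>p. (((\<lambda>(g, x). act g x) \<circ> (\<lambda>p. (fst p, (fst \<circ> snd) p))) p, (snd \<circ> snd) p))"
      using GW by (intro continuous_map_pairedI continuous_map_compose[OF 1]
          continuous_map_compose[OF continuous_map_snd continuous_map_snd]) (auto simp: G_space_def)
    then show "continuous_map ?Q ?P (\<lambda>(g, x). ?a g x)"
      by (rule continuous_map_eq) auto
  qed (use G_space_act[OF GW] in auto)
  obtain \<V> where \<V>: "\<forall>V\<in>\<V>. openin W V \<and> small_subset G T W act V" "\<Union>\<V> = topspace W"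
    by (rule G_metrizable_small_cover[OF W])
  have small: "small_subset G T ?P ?a (V \<times> {0..1})" if V: "small_subset G T W act V" for V
    unfolding small_subset_def
  proof (intro conjI ballI)
    show "V \<times> {0..1} \<subseteq> topspace ?P" using V by (auto simp: small_subset_def)
    fix z assume z: "z \<in> topspace ?P"
    then have z1: "fst z \<in> topspace W" by auto
    obtain U V0 where U: "U \<subseteq> topspace W" "openin W V0" "fst z \<in> V0" "V0 \<subseteq> U"
      and c: "compactin T (T closure_of {g \<in> carrier G. act g ` U \<inter> V \<noteq> {}})"
      by (rule small_subset_nbhd[OF V z1])
    have "nbhd_of ?P {z} (U \<times> {0..1})"
      unfolding nbhd_of_def
    proof (intro conjI exI[of _ "V0 \<times> {0..1}"])
      show "openin ?P (V0 \<times> {0..1})" using U by (simp add: openin_prod_Times_iff)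
    qed (use U z in \<open>auto simp: mem_Times_iff\<close>)
    moreover have "{g \<in> carrier G. ?a g ` (U \<times> {0..1}) \<inter> (V \<times> {0..1}) \<noteq> {}}
        \<subseteq> {g \<in> carrier G. act g ` U \<inter> V \<noteq> {}}"
      by auto
    then have "compactin T (T closure_of {g \<in> carrier G. ?a g ` (U \<times> {0..1}) \<inter> (V \<times> {0..1}) \<noteq> {}})"
      by (intro closed_compactin[OF c closure_of_mono]) auto
    ultimately show "\<exists>U. nbhd_of ?P {z} U \<and>
        compactin T (T closure_of {g \<in> carrier G. ?a g ` U \<inter> (V \<times> {0..1}) \<noteq> {}})" by blast
  qed
  have "proper_G_space G T ?P ?a"
    unfolding proper_G_space_def
  proof (intro conjI exI[of _ "(\<lambda>V. V \<times> {0..1}) ` \<V>"] ballI)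
    show "\<Union>((\<lambda>V. V \<times> {0..1}) ` \<V>) = topspace ?P" using \<V>(2) by auto
  qed (use gs \<V> small in \<open>auto simp: openin_prod_Times_iff\<close>)
  moreover obtain d where d: "Metric_space (topspace W) d"
    "Metric_space.mtopology (topspace W) d = W"
    "\<forall>g\<in>carrier G. \<forall>x\<in>topspace W. \<forall>y\<in>topspace W. d (act g x) (act g y) = d x y"
    by (rule G_metrizable_metric[OF W])
  then interpret D: Metric_space12 "topspace W" d "{0..1::real}" dist
    by (simp add: Metric_space12_def Met_TC.subspace)
  \<comment> \<open>The restricted distance induces the subspace topology of the interval, so the
    product metric induces the topology of \<open>?P\<close>.\<close>
  have "D.M2.mtopology = ?I"
    using Submetric.mtopology_submetric[of UNIV dist "{0..1::real}"]
    by (simp add: Submetric_def Submetric_axioms_def Met_TC.Metric_space_axioms)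
  then have "D.Prod_metric.mtopology = ?P" using d(2) by (simp add: D.mtopology_prod_metric)
  then have "\<exists>d'. Metric_space (topspace ?P) d' \<and> Metric_space.mtopology (topspace ?P) d' = ?P \<and>
       (\<forall>g\<in>carrier G. \<forall>x\<in>topspace ?P. \<forall>y\<in>topspace ?P. d' (?a g x) (?a g y) = d' x y)"
    using d(3) D.prod_metric
    by (intro exI[of _ "prod_dist d dist"]) (auto simp: prod_dist_def)
  ultimately show ?thesis unfolding G_metrizable_def by blast
qed

section \<open>Invariant distance and Urysohn functions\<close>

lemma G_invariant_distance:
  assumes W: "G_metrizable G T W act" and C: "closedin W C" "G_subset G W act C"
  obtains \<delta> :: "'w \<Rightarrow> real" where "continuous_map W euclideanreal \<delta>"
    "\<forall>w\<in>topspace W. 0 \<le> \<delta> w" "\<forall>w\<in>topspace W. \<delta> w = 0 \<longleftrightarrow> w \<in> C"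
    "\<forall>g\<in>carrier G. \<forall>w\<in>topspace W. \<delta> (act g w) = \<delta> w"
proof (cases "C = {}")
  case True
  \<comment> \<open>An infimum over the empty set is of no use; any nonzero constant has the
    required empty zero set.\<close>
  then show ?thesis by (intro that[of "\<lambda>_. 1"]) auto
next
  case False
  obtain d where d: "Metric_space (topspace W) d" "Metric_space.mtopology (topspace W) d = W"
    "\<forall>g\<in>carrier G. \<forall>x\<in>topspace W. \<forall>y\<in>topspace W. d (act g x) (act g y) = d x y"
    by (rule G_metrizable_metric[OF W])
  interpret Metric_space "topspace W" d by fact
  have GW: "G_space G T W act" using W by (rule G_metrizable_G_space)
  have CW: "C \<subseteq> topspace W" using C(1) closedin_subset by blast
  define \<delta> where "\<delta> w = (INF c\<in>C. d w c)" for w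
  have bdd: "bdd_below (d w ` C)" for w by (rule bdd_belowI[of _ 0]) auto
  have le: "\<delta> w \<le> d w c" if "c \<in> C" for w c
    unfolding \<delta>_def by (rule cINF_lower[OF bdd that])
  have ge: "r \<le> \<delta> w" if "\<And>c. c \<in> C \<Longrightarrow> r \<le> d w c" for w r
    unfolding \<delta>_def using False that by (intro cINF_greatest) auto
  have lip: "\<delta> x \<le> d x y + \<delta> y" if "x \<in> topspace W" "y \<in> topspace W" for x y
  proof -
    have "\<delta> x - d x y \<le> d y c" if "c \<in> C" for c
      using le[OF that, of x] triangle[OF \<open>x \<in> _\<close> \<open>y \<in> _\<close>, of c] that CW by auto
    from ge[of "\<delta> x - d x y" y, OF this] show ?thesis by simp
  qed
  have nonneg: "0 \<le> \<delta> w" for w by (rule ge) simp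
  show ?thesis
  proof (rule that[of \<delta>]; (intro ballI impI)?)
    have "continuous_map mtopology euclideanreal \<delta>"
      unfolding continuous_map_from_metric
    proof (intro conjI ballI allI impI)
      fix a U assume a: "a \<in> topspace W" and U: "openin euclideanreal U \<and> \<delta> a \<in> U"
      then obtain r where r: "r > 0" "ball (\<delta> a) r \<subseteq> U"
        by (metis open_contains_ball open_openin)
      have "\<delta> x \<in> U" if "x \<in> topspace W" "d a x < r" for x
        using lip[OF a that(1)] lip[OF that(1) a] that(2) r(2)
        by (auto simp: commute subset_iff dist_real_def abs_if)
      with r show "\<exists>r>0. \<forall>x. x \<in> topspace W \<and> d a x < r \<longrightarrow> \<delta> x \<in> U" by blast
    qed simp
    then show "continuous_map W euclideanreal \<delta>" using d(2) by simp
    show "\<delta> w = 0 \<longleftrightarrow> w \<in> C" if w: "w \<in> topspace W" for w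
    proof
      assume "w \<in> C" with le[OF this, of w] nonneg[of w] w show "\<delta> w = 0" by simp
    next
      assume 0: "\<delta> w = 0"
      show "w \<in> C"
      proof (rule ccontr)
        assume "w \<notin> C"
        then obtain r where r: "r > 0" "disjnt C (mball w r)"
          using C(1) w d(2) closedin_metric by (metis DiffI)
        have "r \<le> d w c" if "c \<in> C" for c
          using r(2) that CW w by (force simp: disjnt_iff)
        from ge[of r w, OF this] show False using 0 r(1) by simp
      qed
    qed
    \<comment> \<open>Translating \<open>c\<close> along with \<open>w\<close> keeps it in
      \<open>C\<close> at the same distance. This gives one inequality for every \<open>g\<close>,
      and the inverse of \<open>g\<close> gives the other.\<close>
    have *: "\<delta> (act g w) \<le> \<delta> w" if g: "g \<in> carrier G" and w: "w \<in> topspace W" for g w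
    proof (rule ge)
      fix c assume c: "c \<in> C"
      then have "act g c \<in> C" using C(2) G_subset_iff[OF GW] g by blast
      from le[OF this, of "act g w"] show "\<delta> (act g w) \<le> d w c" using d(3) g w c CW by auto
    qed
    show "\<delta> (act g w) = \<delta> w" if g: "g \<in> carrier G" and w: "w \<in> topspace W" for g w
      using *[OF g w] *[of "inv g" "act g w"] g w G_space_act(1,4)[OF GW] by simp
  qed (use nonneg in auto)
qed

text \<open>The classical quotient of the distance to \<open>C\<close> by the sum of the distances
  to \<open>C\<close> and \<open>D\<close>; it inherits invariance from the two distances.\<close>

lemma G_invariant_Urysohn:
  assumes W: "G_metrizable G T W act" and C: "closedin W C" "G_subset G W act C"
    and D: "closedin W D" "G_subset G W act D" and CD: "C \<inter> D = {}"
  obtains \<sigma> :: "'w \<Rightarrow> real" where "continuous_map W euclideanreal \<sigma>"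
    "\<forall>w\<in>topspace W. \<sigma> w \<in> {0..1}" "\<forall>w\<in>C. \<sigma> w = 0" "\<forall>w\<in>D. \<sigma> w = 1"
    "\<forall>g\<in>carrier G. \<forall>w\<in>topspace W. \<sigma> (act g w) = \<sigma> w"
proof -
  obtain \<gamma> where \<gamma>: "continuous_map W euclideanreal \<gamma>"
    "\<forall>w\<in>topspace W. 0 \<le> \<gamma> w" "\<forall>w\<in>topspace W. \<gamma> w = 0 \<longleftrightarrow> w \<in> C"
    "\<forall>g\<in>carrier G. \<forall>w\<in>topspace W. \<gamma> (act g w) = \<gamma> w"
    by (rule G_invariant_distance[OF W C])
  obtain \<delta> where \<delta>: "continuous_map W euclideanreal \<delta>"
    "\<forall>w\<in>topspace W. 0 \<le> \<delta> w" "\<forall>w\<in>topspace W. \<delta> w = 0 \<longleftrightarrow> w \<in> D"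
    "\<forall>g\<in>carrier G. \<forall>w\<in>topspace W. \<delta> (act g w) = \<delta> w"
    by (rule G_invariant_distance[OF W D])
  note \<gamma> = \<gamma>[rule_format] and \<delta> = \<delta>[rule_format]
  have CW: "C \<subseteq> topspace W" "D \<subseteq> topspace W" using C(1) D(1) closedin_subset by blast+
  \<comment> \<open>A zero of the sum would be a common zero of both distances, hence a point of the
    empty set \<open>C \<inter> D\<close>.\<close>
  have pos: "0 < \<gamma> w + \<delta> w" if "w \<in> topspace W" for w
    using \<gamma>(2,3)[OF that] \<delta>(2,3)[OF that] CD
    by (metis add_nonneg_eq_0_iff add_nonneg_nonneg disjoint_iff order_le_less)
  show ?thesis
  proof (rule that[of "\<lambda>w. \<gamma> w / (\<gamma> w + \<delta> w)"]; (intro ballI impI)?)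
    show "continuous_map W euclideanreal (\<lambda>w. \<gamma> w / (\<gamma> w + \<delta> w))"
      by (intro continuous_intros \<gamma>(1) \<delta>(1)) (use pos in force)
    show "\<gamma> w / (\<gamma> w + \<delta> w) \<in> {0..1}" if "w \<in> topspace W" for w
      using \<gamma>(2)[OF that] \<delta>(2)[OF that] pos[OF that] by simp
    show "\<gamma> w / (\<gamma> w + \<delta> w) = 0" if "w \<in> C" for w
      using that \<gamma>(3) CW by auto
    show "\<gamma> w / (\<gamma> w + \<delta> w) = 1" if "w \<in> D" for w
      using that \<delta>(3) CW pos by force
  qed (use \<gamma>(4) \<delta>(4) in auto)
qed

text \<open>A test space in the smaller type is copied along \<open>\<iota>\<close>, the extension
  problem is solved for the copy, and the solution is carried back. Thus one sufficiently large type
  provides the extension property for several types.\<close>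

lemma G_ANE_inj:
  fixes \<iota> :: "'w \<Rightarrow> 't"
  assumes T: "topspace T = carrier G" and \<iota>: "inj \<iota>" and Z: "G_ANE TYPE('t) G T Z act"
  shows "G_ANE TYPE('w) G T Z act"
  unfolding G_ANE_def
proof (intro conjI allI impI)
  show "G_space G T Z act" using Z by (simp add: G_ANE_def)
  fix W :: "'w topology" and actW B \<phi>
  assume "G_metrizable G T W actW \<and> closedin W B \<and> G_subset G W actW B \<and>
        G_map G (subtopology W B) actW Z act \<phi>"
  then have W: "G_metrizable G T W actW" and B: "closedin W B" "G_subset G W actW B"
    and \<phi>: "G_map G (subtopology W B) actW Z act \<phi>" by auto
  have GW: "G_space G T W actW" using W by (rule G_metrizable_G_space)
  let ?k = "inv_into UNIV \<iota>"
  \<comment> \<open>The copy of \<open>W\<close>: topology and action are transported along the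
    inverse \<open>?k\<close> of \<open>\<iota>\<close>.\<close>
  let ?S = "\<iota> ` topspace W" and ?a = "\<lambda>g z. \<iota> (actW g (?k z))"
  let ?W = "pullback_topology ?S ?k W"
  have k [simp]: "?k (\<iota> w) = w" for w using \<iota> by simp
  have W': "G_metrizable G T ?W ?a"
    by (rule G_metrizable_pullback[OF T W]) (auto simp: inj_on_def G_space_act[OF GW])
  have GW': "G_space G T ?W ?a" using W' by (rule G_metrizable_G_space)
  have top: "topspace ?W = ?S" by (auto simp: topspace_pullback_topology)
  have ck: "continuous_map ?W W ?k" using continuous_map_pullback[of W W id ?S ?k] by simp
  have c\<iota>: "continuous_map W ?W \<iota>"
    by (rule continuous_map_pullback') (auto simp: o_def)
  have BW: "B \<subseteq> topspace W" using B closedin_subset by blast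
  have B1: "closedin ?W (\<iota> ` B)"
  proof -
    have "\<iota> ` B = {z \<in> topspace ?W. ?k z \<in> B}" using BW top by auto
    with closedin_continuous_map_preimage[OF ck B(1)] show ?thesis by simp
  qed
  have B2: "G_subset G ?W ?a (\<iota> ` B)"
    using B(2) unfolding G_subset_iff[OF GW'] G_subset_iff[OF GW] top by auto
  have B3: "G_map G (subtopology ?W (\<iota> ` B)) ?a Z act (\<phi> \<circ> ?k)"
    unfolding G_map_def
  proof (intro conjI ballI)
    have "continuous_map (subtopology ?W (\<iota> ` B)) (subtopology W B) ?k"
      using ck by (auto simp: continuous_map_in_subtopology continuous_map_from_subtopology)
    then show "continuous_map (subtopology ?W (\<iota> ` B)) Z (\<phi> \<circ> ?k)"
      using \<phi> by (auto simp: G_map_def intro: continuous_map_compose)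
  next
    fix g z assume "g \<in> carrier G" "z \<in> topspace (subtopology ?W (\<iota> ` B))"
    then show "(\<phi> \<circ> ?k) (?a g z) = act g ((\<phi> \<circ> ?k) z)"
      using \<phi> BW by (auto simp: G_map_def)
  qed
  obtain V \<Phi> where V: "openin ?W V" "\<iota> ` B \<subseteq> V" "G_subset G ?W ?a V"
    and \<Phi>: "G_map G (subtopology ?W V) ?a Z act \<Phi>" "\<forall>b\<in>\<iota> ` B. \<Phi> b = (\<phi> \<circ> ?k) b"
    by (rule G_ANE_extend[OF Z T W' B1 B2 B3])
  define U where "U = {w \<in> topspace W. \<iota> w \<in> V}"
  have "openin W U" unfolding U_def by (rule openin_continuous_map_preimage[OF c\<iota> V(1)])
  moreover have "B \<subseteq> U" using V(2) BW unfolding U_def by blast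
  ultimately have "nbhd_of W B U" by (rule nbhd_of_open)
  moreover have "G_subset G W actW U"
    unfolding G_subset_iff[OF GW]
  proof (intro conjI ballI)
    fix g w assume g: "g \<in> carrier G" and w: "w \<in> U"
    then have "?a g (\<iota> w) \<in> V" using V(3) G_subset_iff[OF GW'] unfolding U_def by blast
    then show "actW g w \<in> U" using w g G_space_act(1)[OF GW] by (simp add: U_def)
  qed (auto simp: U_def)
  moreover have "G_map G (subtopology W U) actW Z act (\<Phi> \<circ> \<iota>)"
    unfolding G_map_def
  proof (intro conjI ballI)
    have "continuous_map (subtopology W U) (subtopology ?W V) \<iota>"
      using c\<iota> by (auto simp: continuous_map_in_subtopology continuous_map_from_subtopology U_def)
    then show "continuous_map (subtopology W U) Z (\<Phi> \<circ> \<iota>)"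
      using \<Phi> by (auto simp: G_map_def intro: continuous_map_compose)
  next
    fix g w assume g: "g \<in> carrier G" and w: "w \<in> topspace (subtopology W U)"
    then have "\<iota> w \<in> topspace (subtopology ?W V)" by (auto simp: U_def top)
    with \<Phi>(1) g have "\<Phi> (?a g (\<iota> w)) = act g (\<Phi> (\<iota> w))" unfolding G_map_def by blast
    then show "(\<Phi> \<circ> \<iota>) (actW g w) = act g ((\<Phi> \<circ> \<iota>) w)" by simp
  qed
  moreover have "\<forall>b\<in>B. (\<Phi> \<circ> \<iota>) b = \<phi> b" using \<Phi>(2) by simp
  ultimately show "\<exists>U \<Phi>. nbhd_of W B U \<and> G_subset G W actW U \<and>
      G_map G (subtopology W U) actW Z act \<Phi> \<and> (\<forall>b\<in>B. \<Phi> b = \<phi> b)" by blast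
qed

text \<open>A neighbourhood retraction onto \<open>A\<close> is joined to the identity by extending
  a map prescribed on part of a cylinder. Slowing the time down with an invariant Urysohn function
  then makes the homotopy global, and \<open>\<mu>\<close> records where its end lies in
  \<open>A\<close>.\<close>

lemma G_neighbourhood_deformation:
  fixes X :: "'x topology"
  assumes T: "topspace T = carrier G" and X: "G_metrizable G T X act"
    and A: "closedin X A" "G_subset G X act A"
    and ANE_X: "G_ANE TYPE('x \<times> real) G T X act"
    and ANE_A: "G_ANE TYPE('x) G T (subtopology X A) act"
  obtains H :: "'x \<Rightarrow> real \<Rightarrow> 'x" and \<mu> :: "'x \<Rightarrow> real" where
    "continuous_map (prod_topology X (top_of_set {0..1})) X (\<lambda>(x, t). H x t)"
    "\<forall>g\<in>carrier G. \<forall>x\<in>topspace X. \<forall>t\<in>{0..1}. H (act g x) t = act g (H x t)"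
    "\<forall>x\<in>topspace X. H x 0 = x"
    "\<forall>a\<in>A. \<forall>t\<in>{0..1}. H a t = a"
    "continuous_map X euclideanreal \<mu>"
    "\<forall>g\<in>carrier G. \<forall>x\<in>topspace X. \<mu> (act g x) = \<mu> x"
    "\<forall>a\<in>A. \<mu> a = 1"
    "\<forall>x\<in>topspace X. 1/2 \<le> \<mu> x \<longrightarrow> H x 1 \<in> A"
proof -
  have GX: "G_space G T X act" using X by (rule G_metrizable_G_space)
  have AX: "A \<subseteq> topspace X" using A closedin_subset by blast
  \<comment> \<open>Extending the identity of \<open>A\<close> gives an equivariant retraction
    \<open>r\<close> of an open invariant set \<open>U\<close> onto \<open>A\<close>.\<close>
  have "G_map G (subtopology X A) act (subtopology X A) act id" by (simp add: G_map_def)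
  then obtain U r where U: "openin X U" "A \<subseteq> U" "G_subset G X act U"
    and r: "G_map G (subtopology X U) act (subtopology X A) act r" "\<forall>a\<in>A. r a = id a"
    by (rule G_ANE_extend[OF ANE_A T X A])
  note r = r(1) r(2)[rule_format]
  have UX: "U \<subseteq> topspace X" using U openin_subset by blast
  have rA: "r x \<in> A" if "x \<in> U" for x
    using r(1) that UX unfolding G_map_def continuous_map_def by auto
  let ?I = "top_of_set {0..1::real}"
  let ?P = "prod_topology (subtopology X U) ?I" and ?a = "\<lambda>g (x, t). (act g x, t :: real)"
  have P: "G_metrizable G T ?P ?a"
    by (intro G_metrizable_prod_interval G_metrizable_subtopology T X U)
  have GP: "G_space G T ?P ?a" using P by (rule G_metrizable_G_space)
  have topP: "topspace ?P = U \<times> {0..1}" using UX by auto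
  have gU: "act g x \<in> U" if "g \<in> carrier G" "x \<in> U" for g x
    using U(3) that G_subset_iff[OF GX] by blast
  have gA: "act g x \<in> A" if "g \<in> carrier G" "x \<in> A" for g x
    using A(2) that G_subset_iff[OF GX] by blast
  have cfst: "continuous_map ?P X fst"
    using continuous_map_fst continuous_map_into_fulltopology by blast
  have csnd: "continuous_map ?P euclideanreal snd"
    using continuous_map_snd continuous_map_into_fulltopology by blast
  \<comment> \<open>The homotopy is prescribed on a closed part of the cylinder: \<open>r\<close> on
    \<open>K1\<close>, the first coordinate on \<open>K2\<close>. They overlap only in
    \<open>A \<times> {1}\<close>, where \<open>r\<close> is the identity.\<close>
  define K1 where "K1 = U \<times> {1::real}"
  define K2 where "K2 = U \<times> {0} \<union> A \<times> {0..1::real}"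
  define K where "K = K1 \<union> K2"
  have clA: "closedin ?P {z \<in> topspace ?P. fst z \<in> A}"
    by (rule closedin_continuous_map_preimage[OF cfst A(1)])
  have clt: "closedin ?P {z \<in> topspace ?P. snd z \<in> {t}}" for t
    by (rule closedin_continuous_map_preimage[OF csnd]) simp
  have K1: "closedin ?P K1"
    using clt[of 1] unfolding K1_def topP by (rule back_subst[of "closedin ?P"]) auto
  have K2: "closedin ?P K2"
    using closedin_Un[OF clt[of 0] clA] unfolding K2_def topP
    by (rule back_subst[of "closedin ?P"]) (use U in auto)
  have K: "closedin ?P K" unfolding K_def using K1 K2 by (rule closedin_Un)
  have KG: "G_subset G ?P ?a K"
    unfolding G_subset_iff[OF GP] using closedin_subset[OF K] gU gA
    by (auto simp: K_def K1_def K2_def)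
  define \<kappa> where "\<kappa> z = (if z \<in> K1 then r (fst z) else fst z)" for z :: "'x \<times> real"
  have c\<kappa>: "continuous_map (subtopology ?P K) X \<kappa>"
    unfolding \<kappa>_def
  proof (rule continuous_map_paste_closed)
    show "closedin (subtopology ?P K) K1" "closedin (subtopology ?P K) K2"
      using K1 K2 unfolding K_def by (auto intro: closedin_subset_topspace)
    show "topspace (subtopology ?P K) \<subseteq> K1 \<union> K2" by (auto simp: K_def)
    have "continuous_map (subtopology X U) X r"
      using r(1) unfolding G_map_def by (blast intro: continuous_map_into_fulltopology)
    from continuous_map_compose[OF continuous_map_fst this]
    show "continuous_map (subtopology (subtopology ?P K) K1) X (\<lambda>z. r (fst z))"
      by (auto simp: o_def intro!: continuous_map_from_subtopology)
    show "continuous_map (subtopology (subtopology ?P K) K2) X fst"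
      by (intro continuous_map_from_subtopology cfst)
    show "r (fst z) = fst z" if "z \<in> K1" "z \<in> K2" for z
      using that r(2) by (auto simp: K1_def K2_def)
  qed
  have \<kappa>: "G_map G (subtopology ?P K) ?a X act \<kappa>"
    unfolding G_map_def
  proof (intro conjI ballI c\<kappa>)
    fix g z assume g: "g \<in> carrier G" and z: "z \<in> topspace (subtopology ?P K)"
    obtain x t where xt: "z = (x, t)" by (cases z)
    have x: "x \<in> U" using z xt by simp
    have "r (act g x) = act g (r x)" using r(1) g x UX by (auto simp: G_map_def)
    moreover have "?a g z \<in> K1 \<longleftrightarrow> z \<in> K1" using xt x gU[OF g x] by (auto simp: K1_def)
    ultimately show "\<kappa> (?a g z) = act g (\<kappa> z)" by (simp add: \<kappa>_def xt)
  qed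
  obtain V h where V: "openin ?P V" "K \<subseteq> V" "G_subset G ?P ?a V"
    and h: "G_map G (subtopology ?P V) ?a X act h" "\<forall>z\<in>K. h z = \<kappa> z"
    by (rule G_ANE_extend[OF ANE_X T P K KG \<kappa>])
  note h = h(1) h(2)[rule_format]
  have VP: "V \<subseteq> topspace ?P" using V openin_subset by blast
  \<comment> \<open>Over \<open>V'\<close> the extension \<open>h\<close> is available for all
    times. Compactness of the interval makes \<open>V'\<close> open, by the tube lemma.\<close>
  define V' where "V' = {x \<in> U. {x} \<times> {0..1} \<subseteq> V}"
  have "openin (subtopology X U) V'"
  proof (subst openin_subopen, intro ballI)
    fix x assume x: "x \<in> V'"
    have "\<exists>R S. openin (subtopology X U) R \<and> openin ?I S \<and> x \<in> R \<and> {0..1} \<subseteq> S \<and> R \<times> S \<subseteq> V"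
      by (rule tube_lemma_right[OF V(1)]) (use x UX in \<open>auto simp: V'_def\<close>)
    then obtain R S where R: "openin (subtopology X U) R" "x \<in> R" "{0..1} \<subseteq> S" "R \<times> S \<subseteq> V"
      by blast
    moreover have "R \<subseteq> U" using openin_subset[OF R(1)] by simp
    ultimately show "\<exists>R. openin (subtopology X U) R \<and> x \<in> R \<and> R \<subseteq> V'"
      unfolding V'_def by blast
  qed
  then have V'o: "openin X V'" using U(1) by (simp add: openin_open_subtopology)
  have AV': "A \<subseteq> V'" using V(2) U(2) by (auto simp: V'_def K_def K2_def)
  have gV': "act g x \<in> V'" if "g \<in> carrier G" "x \<in> V'" for g x
  proof -
    have "?a g (x, t) \<in> V" if "t \<in> {0..1}" for t
      using V(3) that \<open>g \<in> _\<close> \<open>x \<in> V'\<close> unfolding G_subset_iff[OF GP] V'_def by blast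
    then show ?thesis using gU that unfolding V'_def by auto
  qed
  have V'G: "G_subset G X act (topspace X - V')"
    unfolding G_subset_iff[OF GX]
  proof (intro conjI ballI)
    fix g x assume g: "g \<in> carrier G" and x: "x \<in> topspace X - V'"
    have "act g x \<notin> V'"
      using gV'[of "inv g" "act g x"] g x G_space_act(4)[OF GX] by auto
    then show "act g x \<in> topspace X - V'" using g x G_space_act(1)[OF GX] by auto
  qed auto
  have V'c: "closedin X (topspace X - V')" using V'o by blast
  obtain \<mu> :: "'x \<Rightarrow> real" where \<mu>: "continuous_map X euclideanreal \<mu>"
    "\<forall>x\<in>topspace X. \<mu> x \<in> {0..1}" "\<forall>x\<in>topspace X - V'. \<mu> x = 0"
    "\<forall>x\<in>A. \<mu> x = 1" "\<forall>g\<in>carrier G. \<forall>x\<in>topspace X. \<mu> (act g x) = \<mu> x"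
    by (rule G_invariant_Urysohn[OF X V'c V'G A]) (use AV' in blast)
  note \<mu> = \<mu>[rule_format]
  \<comment> \<open>The time factor vanishes at level \<open>1/4\<close> of \<open>\<mu>\<close>,
    where \<open>H\<close> must match the identity, and equals 1 from level \<open>1/2\<close> on,
    where the full retraction is wanted. Since \<open>\<mu>\<close> is 0 off \<open>V'\<close>,
    level \<open>1/4\<close> still lies inside \<open>V'\<close>.\<close>
  define m where "m x = max 0 (min 1 (4 * \<mu> x - 1))" for x
  have m01: "t * m x \<in> {0..1}" if "t \<in> {0..1}" for t x
    using that by (auto simp: m_def intro!: mult_le_one)
  have cm: "continuous_map X euclideanreal m"
    unfolding m_def by (intro continuous_intros \<mu>(1))
  define H where "H x t = (if 1/4 \<le> \<mu> x then h (x, t * m x) else x)" for x t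
  have inV: "(x, t * m x) \<in> V" if "x \<in> topspace X" "1/4 \<le> \<mu> x" "t \<in> {0..1}" for x t
  proof -
    have "x \<in> V'" using \<mu>(3)[of x] that by force
    with m01[OF that(3), of x] show ?thesis unfolding V'_def by blast
  qed
  have h0: "h (x, 0) = x" if "x \<in> U" for x
    using h(2)[of "(x, 0)"] that by (simp add: K_def K2_def K1_def \<kappa>_def)
  have inU: "x \<in> U" if "x \<in> topspace X" "1/4 \<le> \<mu> x" for x
    using inV[OF that, of 0] VP by auto
  show ?thesis
  proof (rule that[of H \<mu>]; (intro ballI impI)?)
    let ?Q = "prod_topology X ?I"
    have q1: "continuous_map ?Q euclideanreal (\<lambda>z. \<mu> (fst z))"
      using continuous_map_compose[OF continuous_map_fst \<mu>(1)] by (simp add: o_def)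
    have q2: "continuous_map ?Q euclideanreal (\<lambda>z. m (fst z))"
      using continuous_map_compose[OF continuous_map_fst cm] by (simp add: o_def)
    have q3: "continuous_map ?Q euclideanreal snd"
      using continuous_map_snd continuous_map_into_fulltopology by blast
    have "continuous_map ?Q X (\<lambda>z. if 1/4 \<le> \<mu> (fst z) then h (fst z, snd z * m (fst z)) else fst z)"
    proof (rule continuous_map_cases_le)
      let ?R = "subtopology ?Q {z. z \<in> topspace ?Q \<and> 1/4 \<le> \<mu> (fst z)}"
      have "continuous_map ?R (subtopology ?P V) (\<lambda>z. (fst z, snd z * m (fst z)))"
      proof (intro continuous_map_into_subtopology continuous_map_pairedI)
        show "continuous_map ?R X fst"
          by (intro continuous_map_from_subtopology continuous_map_fst)
        show "fst \<in> topspace ?R \<rightarrow> U" using inU by auto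
        show "continuous_map ?R euclideanreal (\<lambda>z. snd z * m (fst z))"
          by (intro continuous_map_from_subtopology continuous_intros q2 q3)
        show "(\<lambda>z. snd z * m (fst z)) \<in> topspace ?R \<rightarrow> {0..1}" using m01 by fastforce
        show "(\<lambda>z. (fst z, snd z * m (fst z))) \<in> topspace ?R \<rightarrow> V" using inV by auto
      qed
      then have "continuous_map ?R X (h \<circ> (\<lambda>z. (fst z, snd z * m (fst z))))"
        using h(1) unfolding G_map_def by (blast intro: continuous_map_compose)
      then show "continuous_map ?R X (\<lambda>z. h (fst z, snd z * m (fst z)))" by (simp add: o_def)
      show "continuous_map (subtopology ?Q {z. z \<in> topspace ?Q \<and> \<mu> (fst z) \<le> 1/4}) X fst"
        by (intro continuous_map_from_subtopology continuous_map_fst)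
      show "h (fst z, snd z * m (fst z)) = fst z" if "z \<in> topspace ?Q" "1/4 = \<mu> (fst z)" for z
      proof -
        have "m (fst z) = 0" using that(2) by (simp add: m_def)
        moreover have "fst z \<in> U" using that by (intro inU) auto
        ultimately show ?thesis by (simp add: h0)
      qed
    qed (use q1 in auto)
    then show "continuous_map ?Q X (\<lambda>(x, t). H x t)"
      by (rule continuous_map_eq) (auto simp: H_def)
    show "H (act g x) t = act g (H x t)"
      if g: "g \<in> carrier G" and x: "x \<in> topspace X" and t: "t \<in> {0..1}" for g x t
    proof (cases "1/4 \<le> \<mu> x")
      case True
      have "(x, t * m x) \<in> topspace (subtopology ?P V)"
        unfolding topspace_subtopology using inV[OF x True t] VP by blast
      then have "h (?a g (x, t * m x)) = act g (h (x, t * m x))"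
        using h(1) g unfolding G_map_def by blast
      then show ?thesis using True by (simp add: H_def m_def \<mu>(5)[OF g x])
    qed (simp add: H_def \<mu>(5)[OF g x])
    show "H x 0 = x" if "x \<in> topspace X" for x using that h0 inU by (simp add: H_def)
    show "H a t = a" if "a \<in> A" "t \<in> {0..1}" for a t
    proof -
      have "m a = 1" using \<mu>(4)[OF that(1)] by (simp add: m_def)
      moreover have "(a, t) \<in> K" using that by (simp add: K_def K2_def)
      ultimately show ?thesis using h(2)[of "(a, t)"] r(2)[OF that(1)] \<mu>(4)[OF that(1)]
        by (simp add: H_def \<kappa>_def)
    qed
    show "H x 1 \<in> A" if x: "x \<in> topspace X" "1/2 \<le> \<mu> x" for x
    proof -
      have "m x = 1" using x(2) by (simp add: m_def)
      moreover have "(x, 1) \<in> K1" using inU[OF x(1)] x(2) by (simp add: K1_def)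
      moreover have "r x \<in> A" using rA inU[OF x(1)] x(2) by simp
      ultimately show ?thesis using h(2)[of "(x, 1)"] x(2) by (simp add: H_def \<kappa>_def K_def)
    qed
  qed (use \<mu> in auto)
qed

end

section \<open>Attaching along a closed invariant subset\<close>

text \<open>The adjunction space is described through its two canonical maps, so that the main
  argument never meets equivalence classes. The conditions say that \<open>jX\<close> and
  \<open>jY\<close> together form a quotient map identifying exactly what
  \<open>a \<mapsto> f a\<close> forces.\<close>

locale G_attachment = group G
  for G :: "('g, 'm) monoid_scheme" (structure) +
  fixes T :: "'g topology"
    and X :: "'x topology" and actX :: "'g \<Rightarrow> 'x \<Rightarrow> 'x"
    and Y :: "'y topology" and actY :: "'g \<Rightarrow> 'y \<Rightarrow> 'y"
    and A :: "'x set" and f :: "'x \<Rightarrow> 'y"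
    and Z :: "'z topology" and actZ :: "'g \<Rightarrow> 'z \<Rightarrow> 'z"
    and jX :: "'x \<Rightarrow> 'z" and jY :: "'y \<Rightarrow> 'z"
  assumes T: "topspace T = carrier G"
    and X: "G_metrizable G T X actX" and Y: "G_metrizable G T Y actY"
    and Z: "G_metrizable G T Z actZ"
    and A_closed: "closedin X A" and A_inv: "G_subset G X actX A"
    and f_map: "G_map G (subtopology X A) actX Y actY f"
    and jX_map: "G_map G X actX Z actZ jX" and jY_map: "G_map G Y actY Z actZ jY"
    and attach: "a \<in> A \<Longrightarrow> jX a = jY (f a)"
    and inj_jX: "inj_on jX (topspace X - A)" and inj_jY: "inj_on jY (topspace Y)"
    and disj: "\<lbrakk>x \<in> topspace X - A; y \<in> topspace Y\<rbrakk> \<Longrightarrow> jX x \<noteq> jY y"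
    and cover: "topspace Z = jX ` topspace X \<union> jY ` topspace Y"
    and quotient: "\<lbrakk>U \<subseteq> topspace Z; openin X {x \<in> topspace X. jX x \<in> U};
        openin Y {y \<in> topspace Y. jY y \<in> U}\<rbrakk> \<Longrightarrow> openin Z U"
begin

text \<open>\<open>jX\<close> may identify points of \<open>A\<close>, so it is inverted only on the
  complement of \<open>A\<close>; \<open>iX\<close> is meaningful off \<open>YZ\<close>, and
  \<open>iY\<close> on \<open>YZ\<close>.\<close>

abbreviation iX :: "'z \<Rightarrow> 'x" where "iX \<equiv> inv_into (topspace X - A) jX"
abbreviation iY :: "'z \<Rightarrow> 'y" where "iY \<equiv> inv_into (topspace Y) jY"
abbreviation YZ :: "'z set" where "YZ \<equiv> jY ` topspace Y"

section \<open>Points of the attached space and equivariance of the partial inverses\<close>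

lemma GX: "G_space G T X actX" and GY: "G_space G T Y actY" and GZ: "G_space G T Z actZ"
  using X Y Z by (auto intro: G_metrizable_G_space)

lemma A_subset: "A \<subseteq> topspace X"
  using A_closed closedin_subset by blast

lemma f_A: "a \<in> A \<Longrightarrow> f a \<in> topspace Y"
  using f_map A_subset by (auto simp: G_map_def continuous_map_def)

lemma jX_Z: "x \<in> topspace X \<Longrightarrow> jX x \<in> topspace Z" and jY_Z: "y \<in> topspace Y \<Longrightarrow> jY y \<in> topspace Z"
  using cover by auto

lemma jX_cont: "continuous_map X Z jX" and jY_cont: "continuous_map Y Z jY"
  using jX_map jY_map by (auto simp: G_map_def)

lemma jX_act: "g \<in> carrier G \<Longrightarrow> x \<in> topspace X \<Longrightarrow> jX (actX g x) = actZ g (jX x)"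
  and jY_act: "g \<in> carrier G \<Longrightarrow> y \<in> topspace Y \<Longrightarrow> jY (actY g y) = actZ g (jY y)"
  using jX_map jY_map by (auto simp: G_map_def)

lemma iX_jX: "x \<in> topspace X - A \<Longrightarrow> iX (jX x) = x"
  and iY_jY: "y \<in> topspace Y \<Longrightarrow> iY (jY y) = y"
  using inj_jX inj_jY by (auto intro: inv_into_f_f)

lemma jX_in_YZ: "x \<in> topspace X \<Longrightarrow> jX x \<in> YZ \<longleftrightarrow> x \<in> A"
proof
  assume "x \<in> topspace X" "jX x \<in> YZ"
  then show "x \<in> A" using disj by blast
next
  assume "x \<in> A" then show "jX x \<in> YZ" using attach f_A by simp
qed

lemma Z_cases:
  assumes "z \<in> topspace Z"
  obtains x where "x \<in> topspace X - A" "z = jX x" "z \<notin> YZ"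
  | y where "y \<in> topspace Y" "z = jY y" "z \<in> YZ"
proof (cases "z \<in> YZ")
  case False
  then obtain x where "x \<in> topspace X" "z = jX x" using assms cover by blast
  with False jX_in_YZ that(1) show ?thesis by blast
qed (use that(2) in blast)

lemma iX_props:
  assumes "z \<in> topspace Z" "z \<notin> YZ"
  shows "iX z \<in> topspace X" "iX z \<notin> A" "jX (iX z) = z"
  using assms by (cases rule: Z_cases; simp add: iX_jX)+

lemma YZ_inv: "G_subset G Z actZ YZ"
  unfolding G_subset_iff[OF GZ]
proof (intro conjI ballI)
  fix g z assume "g \<in> carrier G" "z \<in> YZ"
  then obtain y where "y \<in> topspace Y" "z = jY y" by blast
  then show "actZ g z \<in> YZ"
    using jY_act[OF \<open>g \<in> _\<close>] G_space_act(1)[OF GY \<open>g \<in> _\<close>] by (metis imageI)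
qed (use jY_Z in blast)

lemma iX_act:
  assumes g: "g \<in> carrier G" and z: "z \<in> topspace Z" "z \<notin> YZ"
  shows "iX (actZ g z) = actX g (iX z)"
proof -
  obtain x where x: "x \<in> topspace X - A" "z = jX x" using z by (cases rule: Z_cases) auto
  then have "actX g x \<in> topspace X - A"
    using G_space_act(1)[OF GX g] G_subset_act_iff[OF GX A_inv g] by blast
  from iX_jX[OF this] show ?thesis using x iX_jX[OF x(1)] jX_act[OF g] by simp
qed

lemma iY_act:
  assumes g: "g \<in> carrier G" and z: "z \<in> YZ"
  shows "iY (actZ g z) = actY g (iY z)"
proof -
  obtain y where y: "y \<in> topspace Y" "z = jY y" using z by blast
  from iY_jY[OF G_space_act(1)[OF GY g y(1)]] show ?thesis
    using y iY_jY[OF y(1)] jY_act[OF g] by simp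
qed

section \<open>Topology of the attached space\<close>

lemma quotient_closed:
  assumes "U \<subseteq> topspace Z" "closedin X {x \<in> topspace X. jX x \<in> U}"
    "closedin Y {y \<in> topspace Y. jY y \<in> U}"
  shows "closedin Z U"
  unfolding closedin_def
proof (intro conjI quotient)
  have "{x \<in> topspace X. jX x \<in> topspace Z - U} = topspace X - {x \<in> topspace X. jX x \<in> U}"
       "{y \<in> topspace Y. jY y \<in> topspace Z - U} = topspace Y - {y \<in> topspace Y. jY y \<in> U}"
    using jX_Z jY_Z by auto
  then show "openin X {x \<in> topspace X. jX x \<in> topspace Z - U}"
    "openin Y {y \<in> topspace Y. jY y \<in> topspace Z - U}"
    using assms(2,3) by auto
qed (use assms in auto)

lemma jY_closed:
  assumes "closedin Y C"
  shows "closedin Z (jY ` C)"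
proof (rule quotient_closed)
  have CY: "C \<subseteq> topspace Y" using assms closedin_subset by blast
  show "jY ` C \<subseteq> topspace Z" using CY jY_Z by blast
  have "{y \<in> topspace Y. jY y \<in> jY ` C} = C" using CY inj_jY by (auto dest: inj_onD)
  with assms show "closedin Y {y \<in> topspace Y. jY y \<in> jY ` C}" by simp
  have "closedin (subtopology X A) {x \<in> topspace (subtopology X A). f x \<in> C}"
    using f_map assms unfolding G_map_def by (blast intro: closedin_continuous_map_preimage)
  then have "closedin X {x \<in> topspace (subtopology X A). f x \<in> C}"
    using A_closed closedin_trans_full by blast
  moreover have "{x \<in> topspace X. jX x \<in> jY ` C} = {x \<in> topspace (subtopology X A). f x \<in> C}"
  proof (intro equalityI subsetI)
    fix x assume x: "x \<in> {x \<in> topspace X. jX x \<in> jY ` C}"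
    then have "x \<in> A" using jX_in_YZ CY by blast
    moreover obtain c where "c \<in> C" "jX x = jY c" using x by blast
    ultimately have "f x = c" using attach f_A inj_jY CY by (metis inj_onD subsetD)
    then show "x \<in> {x \<in> topspace (subtopology X A). f x \<in> C}" using \<open>x \<in> A\<close> \<open>c \<in> C\<close> x by simp
  qed (use attach in auto)
  ultimately show "closedin X {x \<in> topspace X. jX x \<in> jY ` C}" by simp
qed

lemma YZ_closed: "closedin Z YZ"
  by (rule jY_closed) simp

lemma iY_cont: "continuous_map (subtopology Z YZ) Y iY"
  unfolding continuous_map_closedin
proof (intro conjI allI impI)
  show "iY \<in> topspace (subtopology Z YZ) \<rightarrow> topspace Y" using iY_jY by auto
  fix C assume C: "closedin Y C"
  then have "C \<subseteq> topspace Y" by (rule closedin_subset)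
  then have "{z \<in> topspace (subtopology Z YZ). iY z \<in> C} = jY ` C"
    using iY_jY jY_Z by (auto simp: subset_iff image_iff)
  moreover have "closedin (subtopology Z YZ) (jY ` C)"
    using \<open>C \<subseteq> _\<close> by (intro closedin_subset_topspace jY_closed C) auto
  ultimately show "closedin (subtopology Z YZ) {z \<in> topspace (subtopology Z YZ). iY z \<in> C}" by simp
qed

text \<open>For open \<open>U\<close> the set \<open>U - A\<close> is open in \<open>X\<close>, its
  image under \<open>jX\<close> has no other preimages in \<open>X\<close> and misses
  \<open>YZ\<close>; hence the image is open in \<open>Z\<close>.\<close>

lemma iX_cont: "continuous_map (subtopology Z (topspace Z - YZ)) X iX"
  unfolding continuous_map
proof (intro conjI allI impI)
  show "iX ` topspace (subtopology Z (topspace Z - YZ)) \<subseteq> topspace X" using iX_props by auto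
  fix U assume U: "openin X U"
  have "openin Z (jX ` (U - A))"
  proof (rule quotient)
    have UX: "U \<subseteq> topspace X" using U openin_subset by blast
    then show "jX ` (U - A) \<subseteq> topspace Z" using jX_Z by blast
    have "{x \<in> topspace X. jX x \<in> jX ` (U - A)} = U - A"
    proof (intro equalityI subsetI)
      fix x assume x: "x \<in> {x \<in> topspace X. jX x \<in> jX ` (U - A)}"
      then obtain u where u: "u \<in> U - A" "jX x = jX u" by blast
      then have "x \<notin> A" using x jX_in_YZ UX by (metis (mono_tags) DiffD1 DiffD2 mem_Collect_eq subsetD)
      with u x UX inj_onD[OF inj_jX u(2)] show "x \<in> U - A" by auto
    qed (use UX in auto)
    moreover have "openin X (U - A)" using U A_closed by (rule openin_diff)
    ultimately show "openin X {x \<in> topspace X. jX x \<in> jX ` (U - A)}" by simp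
    have "{y \<in> topspace Y. jY y \<in> jX ` (U - A)} = {}" using UX disj by force
    then show "openin Y {y \<in> topspace Y. jY y \<in> jX ` (U - A)}" by (simp only: openin_empty)
  qed
  moreover have "{z \<in> topspace (subtopology Z (topspace Z - YZ)). iX z \<in> U}
      = jX ` (U - A) \<inter> (topspace Z - YZ)"
  proof (intro equalityI subsetI)
    fix z assume z: "z \<in> {z \<in> topspace (subtopology Z (topspace Z - YZ)). iX z \<in> U}"
    then have "z = jX (iX z)" "iX z \<in> U - A" using iX_props[of z] by auto
    with z show "z \<in> jX ` (U - A) \<inter> (topspace Z - YZ)" by auto
  qed (use iX_jX openin_subset[OF U] in auto)
  ultimately show "openin (subtopology Z (topspace Z - YZ))
      {z \<in> topspace (subtopology Z (topspace Z - YZ)). iX z \<in> U}"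
    by (auto simp: openin_subtopology)
qed

lemma continuous_map_glue:
  assumes "continuous_map X R (k \<circ> jX)" "continuous_map Y R (k \<circ> jY)"
  shows "continuous_map Z R k"
  unfolding continuous_map
proof (intro conjI allI impI)
  show "k ` topspace Z \<subseteq> topspace R"
    using assms unfolding cover continuous_map_def by auto
  fix U assume U: "openin R U"
  have "{x \<in> topspace X. jX x \<in> {z \<in> topspace Z. k z \<in> U}} = {x \<in> topspace X. (k \<circ> jX) x \<in> U}"
    "{y \<in> topspace Y. jY y \<in> {z \<in> topspace Z. k z \<in> U}} = {y \<in> topspace Y. (k \<circ> jY) y \<in> U}"
    using jX_Z jY_Z by auto
  then show "openin Z {z \<in> topspace Z. k z \<in> U}"
    using openin_continuous_map_preimage[OF assms(1) U] openin_continuous_map_preimage[OF assms(2) U]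
    by (intro quotient) auto
qed

text \<open>The points of \<open>X\<close> whose whole track stays over \<open>V\<close> form an
  open set by compactness of the interval. As \<open>H\<close> fixes \<open>A\<close> pointwise,
  this set meets \<open>A\<close> exactly over \<open>V\<close>, so it fits together with
  \<open>V \<inter> YZ\<close> to an open set of \<open>Z\<close>. This gives control near
  \<open>YZ\<close> that is uniform in time.\<close>

lemma homotopy_control:
  assumes H: "continuous_map (prod_topology X (top_of_set {0..1::real})) X (\<lambda>(x, t). H x t)"
    and HA: "\<forall>a\<in>A. \<forall>t\<in>{0..1}. H a t = a"
    and V: "openin Z V"
  obtains V' where "openin Z V'" "V' \<inter> YZ = V \<inter> YZ"
    "\<forall>x\<in>topspace X. jX x \<in> V' \<longrightarrow> (\<forall>t\<in>{0..1}. jX (H x t) \<in> V)"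
proof -
  let ?P = "prod_topology X (top_of_set {0..1::real})"
  have VZ: "V \<subseteq> topspace Z" using V openin_subset by blast
  define S where "S = {x \<in> topspace X. \<forall>t\<in>{0..1::real}. jX (H x t) \<in> V}"
  have SX: "openin X S"
  proof (subst openin_subopen, intro ballI)
    fix x assume x: "x \<in> S"
    let ?O = "{z \<in> topspace ?P. (jX \<circ> (\<lambda>(x, t). H x t)) z \<in> V}"
    have "openin ?P ?O"
      by (rule openin_continuous_map_preimage[OF continuous_map_compose[OF H jX_cont] V])
    then have "\<exists>R R'. openin X R \<and> openin (top_of_set {0..1::real}) R' \<and> x \<in> R \<and> {0..1} \<subseteq> R' \<and> R \<times> R' \<subseteq> ?O"
      by (rule tube_lemma_right) (use x in \<open>auto simp: S_def\<close>)
    then obtain R R' where R: "openin X R" "x \<in> R" "{0..1} \<subseteq> R'" "R \<times> R' \<subseteq> ?O" by blast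
    have "y \<in> S" if "y \<in> R" for y
    proof -
      have "(y, t) \<in> ?O" if "t \<in> {0..1}" for t using R(3,4) that \<open>y \<in> R\<close> by blast
      moreover have "y \<in> topspace X" using R(1) that openin_subset by blast
      ultimately show ?thesis by (simp add: S_def)
    qed
    with R show "\<exists>R. openin X R \<and> x \<in> R \<and> R \<subseteq> S" by blast
  qed
  \<comment> \<open>The two branches agree over \<open>A\<close> by \<open>SA\<close>, which is why
    the preimage of \<open>V'\<close> in \<open>X\<close> is just \<open>S\<close>.\<close>
  define V' where "V' = {z \<in> topspace Z. if z \<in> YZ then z \<in> V else iX z \<in> S}"
  have SA: "x \<in> S \<longleftrightarrow> jX x \<in> V" if "x \<in> A" for x
    using HA that A_subset by (auto simp: S_def intro!: bexI[of _ 0])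
  have pX: "{x \<in> topspace X. jX x \<in> V'} = S"
  proof (intro equalityI subsetI)
    fix x assume x: "x \<in> {x \<in> topspace X. jX x \<in> V'}"
    then show "x \<in> S"
      using SA[of x] jX_in_YZ[of x] iX_jX[of x] by (cases "x \<in> A") (auto simp: V'_def split: if_splits)
  next
    fix x assume x: "x \<in> S"
    then have "x \<in> topspace X" by (simp add: S_def)
    with x show "x \<in> {x \<in> topspace X. jX x \<in> V'}"
      using SA[of x] jX_in_YZ[of x] iX_jX[of x] jX_Z[of x] by (cases "x \<in> A") (auto simp: V'_def)
  qed
  have pY: "{y \<in> topspace Y. jY y \<in> V'} = {y \<in> topspace Y. jY y \<in> V}"
    using jY_Z by (auto simp: V'_def)
  have "openin Z V'"
  proof (rule quotient)
    show "V' \<subseteq> topspace Z" by (auto simp: V'_def)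
    show "openin X {x \<in> topspace X. jX x \<in> V'}" by (simp only: pX SX)
    show "openin Y {y \<in> topspace Y. jY y \<in> V'}"
      unfolding pY by (rule openin_continuous_map_preimage[OF jY_cont V])
  qed
  moreover have "V' \<inter> YZ = V \<inter> YZ" using VZ by (auto simp: V'_def)
  moreover have "\<forall>x\<in>topspace X. jX x \<in> V' \<longrightarrow> (\<forall>t\<in>{0..1}. jX (H x t) \<in> V)"
    using pX by (auto simp: S_def)
  ultimately show ?thesis by (rule that)
qed

text \<open>The types in the hypotheses are those of the spaces where extensions are made: a
  cylinder over part of \<open>X\<close> for the homotopy, \<open>X\<close> itself for the
  retraction, and the test space \<open>W\<close> or its open part for maps into \<open>X\<close>
  and \<open>Y\<close>.\<close>

theorem G_ANE_attachment:
  assumes ANE_XI: "G_ANE TYPE('x \<times> real) G T X actX"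
    and ANE_A: "G_ANE TYPE('x) G T (subtopology X A) actX"
    and ANE_X: "G_ANE TYPE('w) G T X actX" and ANE_Y: "G_ANE TYPE('w) G T Y actY"
  shows "G_ANE TYPE('w) G T Z actZ"
  unfolding G_ANE_def
proof (intro conjI allI impI GZ)
  fix W :: "'w topology" and actW B \<phi>
  assume "G_metrizable G T W actW \<and> closedin W B \<and> G_subset G W actW B \<and>
        G_map G (subtopology W B) actW Z actZ \<phi>"
  then have W: "G_metrizable G T W actW" and B: "closedin W B" "G_subset G W actW B"
    and \<phi>: "G_map G (subtopology W B) actW Z actZ \<phi>" by auto
  have GW: "G_space G T W actW" using W by (rule G_metrizable_G_space)
  note actW = G_space_act(1)[OF GW]
  have BW: "B \<subseteq> topspace W" using B closedin_subset by blast
  have \<phi>_cont: "continuous_map (subtopology W B) Z \<phi>" using \<phi> by (simp add: G_map_def)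
  have \<phi>_Z: "\<phi> b \<in> topspace Z" if "b \<in> B" for b
    using \<phi>_cont that BW by (auto simp: continuous_map_def)
  have \<phi>_act: "\<phi> (actW g b) = actZ g (\<phi> b)" if "g \<in> carrier G" "b \<in> B" for g b
    using \<phi> that BW by (auto simp: G_map_def)
  have B_act: "actW g w \<in> B \<longleftrightarrow> w \<in> B" if "g \<in> carrier G" "w \<in> topspace W" for g w
    by (rule G_subset_act_iff[OF GW B(2) that])

  \<comment> \<open>The deformation of \<open>X\<close> near \<open>A\<close>\<close>
  obtain H :: "'x \<Rightarrow> real \<Rightarrow> 'x" and \<mu> :: "'x \<Rightarrow> real" where
    H: "continuous_map (prod_topology X (top_of_set {0..1})) X (\<lambda>(x, t). H x t)"
      "\<forall>g\<in>carrier G. \<forall>x\<in>topspace X. \<forall>t\<in>{0..1}. H (actX g x) t = actX g (H x t)"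
      "\<forall>x\<in>topspace X. H x 0 = x" "\<forall>a\<in>A. \<forall>t\<in>{0..1}. H a t = a"
    and \<mu>: "continuous_map X euclideanreal \<mu>"
      "\<forall>g\<in>carrier G. \<forall>x\<in>topspace X. \<mu> (actX g x) = \<mu> x"
      "\<forall>a\<in>A. \<mu> a = 1" "\<forall>x\<in>topspace X. 1/2 \<le> \<mu> x \<longrightarrow> H x 1 \<in> A"
    by (rule G_neighbourhood_deformation[OF T X A_closed A_inv ANE_XI ANE_A])
  have H_X: "H x t \<in> topspace X" if "x \<in> topspace X" "t \<in> {0..1}" for x t
    using H(1) that by (auto simp: continuous_map_def Pi_iff)

  \<comment> \<open>Splitting \<open>B\<close> over \<open>YZ\<close> and lifting the rest to
    \<open>X\<close>\<close>
  define BY where "BY = {b \<in> B. \<phi> b \<in> YZ}"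
  have BY: "closedin W BY"
  proof -
    have "closedin (subtopology W B) {b \<in> topspace (subtopology W B). \<phi> b \<in> YZ}"
      by (rule closedin_continuous_map_preimage[OF \<phi>_cont YZ_closed])
    moreover have "{b \<in> topspace (subtopology W B). \<phi> b \<in> YZ} = BY"
      using BW by (auto simp: BY_def)
    ultimately show ?thesis using B(1) closedin_trans_full by metis
  qed
  have BY_B: "w \<in> B" "\<phi> w \<in> YZ" if "w \<in> BY" for w using that by (simp_all add: BY_def)
  have BY_W: "BY \<subseteq> topspace W" using BY closedin_subset by blast
  have BY_act: "actW g w \<in> BY \<longleftrightarrow> w \<in> BY" if "g \<in> carrier G" "w \<in> topspace W" for g w
    unfolding BY_def using B_act[OF that] \<phi>_act[OF that(1)]
      G_subset_act_iff[OF GZ YZ_inv that(1) \<phi>_Z]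
    by (cases "w \<in> B") simp_all
  have BY_inv: "G_subset G W actW BY"
    unfolding G_subset_iff[OF GW] using BY_W BY_act by blast
  \<comment> \<open>\<open>D\<close> may accumulate at \<open>BY\<close> and so need not be closed
    in \<open>W\<close>, but it is closed in the open set \<open>E\<close>. Hence \<open>E\<close>
    serves as the test space for the lift.\<close>
  define E where "E = topspace W - BY"
  define D where "D = B - BY"
  have E_open: "openin W E" unfolding E_def using BY by blast
  have E_W: "E \<subseteq> topspace W" and DE: "D \<subseteq> E" using BW by (auto simp: E_def D_def)
  have E_act: "actW g w \<in> E \<longleftrightarrow> w \<in> E" if "g \<in> carrier G" "w \<in> topspace W" for g w
    unfolding E_def using BY_act[OF that] actW[OF that] that(2) by blast
  have D_act: "actW g w \<in> D \<longleftrightarrow> w \<in> D" if "g \<in> carrier G" "w \<in> topspace W" for g w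
    unfolding D_def using BY_act[OF that] B_act[OF that] by blast
  have E_inv: "G_subset G W actW E"
    unfolding G_subset_iff[OF GW] using E_W E_act by blast
  let ?E = "subtopology W E"
  have WE: "G_metrizable G T ?E actW" by (rule G_metrizable_subtopology[OF T W E_inv])
  have GE: "G_space G T ?E actW" using WE by (rule G_metrizable_G_space)
  have topE: "topspace ?E = E" using E_W by auto
  have D_closed: "closedin ?E D"
    using B(1) DE unfolding closedin_subtopology D_def E_def by blast
  have D_inv: "G_subset G ?E actW D"
    unfolding G_subset_iff[OF GE] topE using DE D_act E_W by blast
  have \<phi>_D: "\<phi> b \<in> topspace Z" "\<phi> b \<notin> YZ" if "b \<in> D" for b
    using that \<phi>_Z by (auto simp: D_def BY_def)
  have "G_map G (subtopology ?E D) actW X actX (iX \<circ> \<phi>)"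
    unfolding G_map_def
  proof (intro conjI ballI)
    have "continuous_map (subtopology W D) (subtopology Z (topspace Z - YZ)) \<phi>"
      using \<phi>_D by (intro continuous_map_into_subtopology
          continuous_map_from_subtopology_mono[OF \<phi>_cont]) (auto simp: D_def)
    then have "continuous_map (subtopology W D) X (iX \<circ> \<phi>)"
      by (rule continuous_map_compose[OF _ iX_cont])
    then show "continuous_map (subtopology ?E D) X (iX \<circ> \<phi>)"
      using DE by (simp add: subtopology_subtopology Int_absorb1)
    fix g b assume "g \<in> carrier G" "b \<in> topspace (subtopology ?E D)"
    then show "(iX \<circ> \<phi>) (actW g b) = actX g ((iX \<circ> \<phi>) b)"
      using \<phi>_D \<phi>_act iX_act by (simp add: D_def)
  qed
  then obtain M \<xi> where M: "openin ?E M" "D \<subseteq> M" "G_subset G ?E actW M"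
    and \<xi>: "G_map G (subtopology ?E M) actW X actX \<xi>" "\<forall>b\<in>D. \<xi> b = (iX \<circ> \<phi>) b"
    by (rule G_ANE_extend[OF ANE_X T WE D_closed D_inv])
  have ME: "M \<subseteq> E" using M(1) openin_subset topE by blast
  have M_open: "openin W M" using M(1) E_open by (simp add: openin_open_subtopology)
  have M_act: "actW g w \<in> M" if "g \<in> carrier G" "w \<in> M" for g w
    using M(3) that unfolding G_subset_iff[OF GE] by blast
  have \<xi>_cont: "continuous_map (subtopology W M) X \<xi>"
    using \<xi>(1) ME by (simp add: G_map_def subtopology_subtopology Int_absorb1)
  have \<xi>_X: "\<xi> w \<in> topspace X" if "w \<in> M" for w
    using \<xi>_cont that ME E_W by (auto simp: continuous_map_def)
  have \<xi>_act: "\<xi> (actW g w) = actX g (\<xi> w)" if "g \<in> carrier G" "w \<in> M" for g w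
    using \<xi>(1) that ME E_W by (auto simp: G_map_def)
  have \<xi>_D: "jX (\<xi> b) = \<phi> b" if "b \<in> D" for b
    using \<xi>(2) that iX_props(3)[OF \<phi>_D[OF that]] by simp
  have jX\<xi>_cont: "continuous_map (subtopology W M) Z (\<lambda>w. jX (\<xi> w))"
    using continuous_map_compose[OF \<xi>_cont jX_cont] by (simp add: o_def)

  \<comment> \<open>A thin invariant neighbourhood of \<open>D\<close>\<close>
  obtain \<delta> where \<delta>: "continuous_map W euclideanreal \<delta>"
    "\<forall>w\<in>topspace W. 0 \<le> \<delta> w" "\<forall>w\<in>topspace W. \<delta> w = 0 \<longleftrightarrow> w \<in> BY"
    "\<forall>g\<in>carrier G. \<forall>w\<in>topspace W. \<delta> (actW g w) = \<delta> w"
    by (rule G_invariant_distance[OF W BY BY_inv])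
  obtain dW where dW: "Metric_space (topspace W) dW" "Metric_space.mtopology (topspace W) dW = W"
    "\<forall>g\<in>carrier G. \<forall>x\<in>topspace W. \<forall>y\<in>topspace W. dW (actW g x) (actW g y) = dW x y"
    by (rule G_metrizable_metric[OF W])
  obtain dZ where dZ: "Metric_space (topspace Z) dZ" "Metric_space.mtopology (topspace Z) dZ = Z"
    "\<forall>g\<in>carrier G. \<forall>x\<in>topspace Z. \<forall>y\<in>topspace Z. dZ (actZ g x) (actZ g y) = dZ x y"
    by (rule G_metrizable_metric[OF Z])
  interpret dW: Metric_space "topspace W" dW by fact
  interpret dZ: Metric_space "topspace Z" dZ by fact

  txt \<open>\<open>\<delta>\<close> vanishes exactly on \<open>BY\<close>, so as \<open>w \<in> N0\<close> tends to a point of \<open>BY\<close> the witness \<open>b\<close> tends to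
    the same point and drags \<open>jX (\<xi> w)\<close> along with \<open>\<phi> b\<close>.\<close>
  define N0 where
    "N0 = {w \<in> M. \<exists>b\<in>D. dW w b < \<delta> w \<and> dZ (jX (\<xi> w)) (\<phi> b) < \<delta> w}"
  have N0M: "N0 \<subseteq> M" by (auto simp: N0_def)
  have N0_open: "openin W N0"
  proof -
    have "openin W {w \<in> M. dW w b < \<delta> w \<and> dZ (jX (\<xi> w)) (\<phi> b) < \<delta> w}" if b: "b \<in> D" for b
    proof -
      have "b \<in> topspace W" using b DE E_W by blast
      from dW.continuous_map_dist_point[OF this]
      have c1: "continuous_map W euclideanreal (\<lambda>w. dW w b)" using dW(2) by simp
      from dZ.continuous_map_dist_point[OF \<phi>_D(1)[OF b]]
      have "continuous_map Z euclideanreal (\<lambda>z. dZ z (\<phi> b))" using dZ(2) by simp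
      from continuous_map_compose[OF jX\<xi>_cont this]
      have c2: "continuous_map (subtopology W M) euclideanreal (\<lambda>w. dZ (jX (\<xi> w)) (\<phi> b))"
        by (simp add: o_def)
      have "openin (subtopology W M) {w \<in> topspace (subtopology W M).
          max (dW w b) (dZ (jX (\<xi> w)) (\<phi> b)) - \<delta> w \<in> {..<0}}"
        by (intro openin_continuous_map_preimage[where Y = euclideanreal] continuous_intros
            continuous_map_from_subtopology[OF c1] c2 continuous_map_from_subtopology[OF \<delta>(1)]) auto
      moreover have "{w \<in> topspace (subtopology W M).
          max (dW w b) (dZ (jX (\<xi> w)) (\<phi> b)) - \<delta> w \<in> {..<0}}
        = {w \<in> M. dW w b < \<delta> w \<and> dZ (jX (\<xi> w)) (\<phi> b) < \<delta> w}"
        using ME E_W by auto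
      ultimately show ?thesis using M_open by (simp add: openin_open_subtopology)
    qed
    then have "openin W (\<Union>b\<in>D. {w \<in> M. dW w b < \<delta> w \<and> dZ (jX (\<xi> w)) (\<phi> b) < \<delta> w})"
      by blast
    moreover have "(\<Union>b\<in>D. {w \<in> M. dW w b < \<delta> w \<and> dZ (jX (\<xi> w)) (\<phi> b) < \<delta> w}) = N0"
      by (auto simp: N0_def)
    ultimately show ?thesis by simp
  qed
  have DN0: "D \<subseteq> N0"
  proof
    fix b assume b: "b \<in> D"
    then have bW: "b \<in> topspace W" "b \<notin> BY" using DE by (auto simp: E_def)
    then have "0 < \<delta> b" using \<delta>(2,3) by (metis order_le_less)
    moreover have "dW b b = 0" "dZ (jX (\<xi> b)) (\<phi> b) = 0"
      using bW \<xi>_D[OF b] \<phi>_D[OF b] by auto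
    ultimately show "b \<in> N0" using b M(2) by (auto simp: N0_def intro!: bexI[of _ b])
  qed
  \<comment> \<open>The translate of a witness for \<open>w\<close> is a witness for the translate
    of \<open>w\<close>, as both metrics and \<open>\<delta>\<close> are invariant.\<close>
  have N0_act: "actW g w \<in> N0" if g: "g \<in> carrier G" and w: "w \<in> N0" for g w
  proof -
    obtain b where b: "b \<in> D" "dW w b < \<delta> w" "dZ (jX (\<xi> w)) (\<phi> b) < \<delta> w" and wM: "w \<in> M"
      using w by (auto simp: N0_def)
    have W2: "w \<in> topspace W" "b \<in> topspace W" using wM ME E_W b(1) DE by auto
    have "dW (actW g w) (actW g b) = dW w b" "\<delta> (actW g w) = \<delta> w"
      using dW(3) \<delta>(4) g W2 by auto
    moreover have "jX (\<xi> (actW g w)) = actZ g (jX (\<xi> w))"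
      using \<xi>_act[OF g wM] jX_act[OF g \<xi>_X[OF wM]] by simp
    moreover have "\<phi> (actW g b) = actZ g (\<phi> b)" using \<phi>_act g b(1) by (simp add: D_def)
    ultimately have "dZ (jX (\<xi> (actW g w))) (\<phi> (actW g b)) = dZ (jX (\<xi> w)) (\<phi> b)"
      using dZ(3) g jX_Z[OF \<xi>_X[OF wM]] \<phi>_D(1)[OF b(1)] by simp
    moreover have "actW g b \<in> D" using D_act g W2 b(1) by blast
    ultimately show ?thesis
      using b \<open>dW _ _ = _\<close> \<open>\<delta> _ = _\<close> M_act[OF g wM] unfolding N0_def
      by (intro CollectI conjI bexI[of _ "actW g b"]) simp_all
  qed
  have N0c: "closedin ?E (E - N0)"
    using N0_open N0M ME topE by (metis closedin_def double_diff openin_subset_topspace_eq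
        Diff_subset openin_open_subtopology E_open order_trans subset_refl)
  have N0c_inv: "G_subset G ?E actW (E - N0)"
    unfolding G_subset_iff[OF GE] topE
  proof (intro conjI ballI)
    fix g w assume g: "g \<in> carrier G" and w: "w \<in> E - N0"
    have "actW g w \<notin> N0"
      using N0_act[of "inv g" "actW g w"] G_space_act(4)[OF GW g] g w E_W by auto
    then show "actW g w \<in> E - N0" using E_act g w E_W by blast
  qed auto
  \<comment> \<open>The separation takes place in \<open>E\<close>, where \<open>D\<close> and the
    complement of \<open>N0\<close> are closed; \<open>\<tau>\<close> need not extend continuously
    over \<open>BY\<close>.\<close>
  obtain \<tau> :: "'w \<Rightarrow> real" where \<tau>: "continuous_map ?E euclideanreal \<tau>"
    "\<forall>w\<in>topspace ?E. \<tau> w \<in> {0..1}" "\<forall>w\<in>D. \<tau> w = 0" "\<forall>w\<in>E - N0. \<tau> w = 1"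
    "\<forall>g\<in>carrier G. \<forall>w\<in>topspace ?E. \<tau> (actW g w) = \<tau> w"
    by (rule G_invariant_Urysohn[OF WE D_closed D_inv N0c N0c_inv]) (use DN0 in blast)
  define F where "F = {w \<in> E. \<tau> w \<le> 1/2}"
  define F0 where "F0 = {w \<in> E. \<tau> w < 1/2}"
  have FE: "F \<subseteq> E" and F0F: "F0 \<subseteq> F" by (auto simp: F_def F0_def)
  have FN0: "F \<subseteq> N0" using \<tau>(4) by (force simp: F_def)
  have FM: "F \<subseteq> M" using FN0 N0M by blast
  have DF0: "D \<subseteq> F0" using \<tau>(3) DE by (auto simp: F0_def)
  have F_act: "actW g w \<in> F \<longleftrightarrow> w \<in> F" "actW g w \<in> F0 \<longleftrightarrow> w \<in> F0"
    if "g \<in> carrier G" "w \<in> topspace W" for g w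
    using E_act[OF that] \<tau>(5) that unfolding F_def F0_def topE by auto
  have F0_open: "openin W F0"
  proof -
    have "openin ?E {w \<in> topspace ?E. \<tau> w \<in> {..<1/2}}"
      by (rule openin_continuous_map_preimage[OF \<tau>(1)]) simp
    moreover have "{w \<in> topspace ?E. \<tau> w \<in> {..<1/2}} = F0" unfolding topE by (auto simp: F0_def)
    ultimately show ?thesis using E_open by (simp add: openin_open_subtopology)
  qed
  \<comment> \<open>\<open>F\<close> is closed only in \<open>E\<close>. Adding all of
    \<open>BY\<close> makes it closed in \<open>W\<close>, since the complement is the open part of
    \<open>E\<close> where \<open>\<tau>\<close> exceeds \<open>1/2\<close>.\<close>
  define Q where "Q = F \<union> BY"
  have Q_W: "Q \<subseteq> topspace W" using FE E_W BY_W by (auto simp: Q_def)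
  have Q_closed: "closedin W Q"
  proof -
    have "openin ?E {w \<in> topspace ?E. \<tau> w \<in> {1/2<..}}"
      by (rule openin_continuous_map_preimage[OF \<tau>(1)]) simp
    moreover have "{w \<in> topspace ?E. \<tau> w \<in> {1/2<..}} = {w \<in> E. 1/2 < \<tau> w}"
      unfolding topE by auto
    ultimately have "openin W {w \<in> E. 1/2 < \<tau> w}"
      using E_open by (simp only: openin_open_subtopology)
    moreover have "topspace W - Q = {w \<in> E. 1/2 < \<tau> w}"
      by (auto simp: Q_def F_def E_def)
    ultimately show ?thesis using Q_W by (simp add: closedin_def)
  qed
  have Q_act: "actW g w \<in> Q \<longleftrightarrow> w \<in> Q" if "g \<in> carrier G" "w \<in> topspace W" for g w
    unfolding Q_def using F_act[OF that] BY_act[OF that] by blast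
  have F_BY: "F \<inter> BY = {}" using FE by (auto simp: E_def)
  have BQ: "B \<subseteq> Q" using DF0 F0F by (auto simp: Q_def D_def)

  \<comment> \<open>Deformed lifts and their continuity across \<open>BY\<close>\<close>
  define K where "K s w = (if w \<in> BY then \<phi> w else jX (H (\<xi> w) (s w)))" for s :: "'w \<Rightarrow> real" and w
  have K_BY: "K s w = \<phi> w" if "w \<in> BY" for s w using that by (simp add: K_def)
  have K_F: "K s w = jX (H (\<xi> w) (s w))" if "w \<in> F" for s w
    using that F_BY by (auto simp: K_def)
  \<comment> \<open>Continuity of \<open>s\<close> is asked on \<open>F\<close> only; its behaviour
    towards \<open>BY\<close> is irrelevant because the control near \<open>BY\<close> is uniform in
    time.\<close>
  have K_cont: "continuous_map (subtopology W Q) Z (K s)"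
    if s: "continuous_map (subtopology W F) (top_of_set {0..1}) s" for s
    unfolding continuous_map_eq_topcontinuous_at topcontinuous_at_def
  proof (intro ballI conjI allI impI)
    have s01: "s w \<in> {0..1}" if "w \<in> F" for w
      using s that FE E_W by (auto simp: continuous_map_def Pi_iff)
    show K_Z: "K s \<in> topspace (subtopology W Q) \<rightarrow> topspace Z"
    proof
      fix w assume "w \<in> topspace (subtopology W Q)"
      then consider "w \<in> BY" | "w \<in> F" by (auto simp: Q_def)
      then show "K s w \<in> topspace Z"
      proof cases
        case 1 then show ?thesis using K_BY \<phi>_Z by (simp add: BY_def)
      next
        case 2 then show ?thesis using K_F jX_Z H_X \<xi>_X s01 FM by auto
      qed
    qed
    fix w V assume w: "w \<in> topspace (subtopology W Q)" and V: "openin Z V \<and> K s w \<in> V"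
    then consider "w \<in> F" | "w \<in> BY" by (auto simp: Q_def)
    then show "\<exists>U. openin (subtopology W Q) U \<and> w \<in> U \<and> (\<forall>y\<in>U. K s y \<in> V)"
    proof cases
      case 1
      have "continuous_map (subtopology W F) (prod_topology X (top_of_set {0..1})) (\<lambda>w. (\<xi> w, s w))"
        by (intro continuous_map_pairedI s continuous_map_from_subtopology_mono[OF \<xi>_cont FM])
      from continuous_map_compose[OF continuous_map_compose[OF this H(1)] jX_cont]
      have "continuous_map (subtopology W F) Z (\<lambda>w. jX (H (\<xi> w) (s w)))" by (simp add: o_def)
      then have "openin (subtopology W F) {w \<in> topspace (subtopology W F). jX (H (\<xi> w) (s w)) \<in> V}"
        by (rule openin_continuous_map_preimage) (use V in blast)
      then obtain R where R: "openin W R"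
        "{w \<in> topspace (subtopology W F). jX (H (\<xi> w) (s w)) \<in> V} = R \<inter> F"
        unfolding openin_subtopology by blast
      have "w \<in> R" using 1 R(2) V K_F[OF 1] FE E_W by auto
      \<comment> \<open>Intersecting with \<open>E\<close> removes \<open>BY\<close>, so only the
        homotopy formula is in force.\<close>
      moreover have "K s y \<in> V" if "y \<in> Q \<inter> (R \<inter> E)" for y
      proof -
        have "y \<in> F" using that by (auto simp: Q_def E_def)
        then show ?thesis using that R(2) K_F by auto
      qed
      moreover have "openin (subtopology W Q) (Q \<inter> (R \<inter> E))"
        using R(1) E_open by (intro openin_subtopology_Int2 openin_Int)
      ultimately show ?thesis using 1 w FE by (intro exI[of _ "Q \<inter> (R \<inter> E)"]) auto
    next
      case 2
      have Vo: "openin Z V" and \<phi>V: "\<phi> w \<in> V" using V K_BY[OF 2] by auto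
      \<comment> \<open>It now suffices to bring \<open>jX (\<xi> v)\<close> into \<open>V'\<close>:
        from there the homotopy stays over \<open>V\<close> whatever the value of
        \<open>s v\<close>.\<close>
      obtain V' where V': "openin Z V'" "V' \<inter> YZ = V \<inter> YZ"
        "\<forall>x\<in>topspace X. jX x \<in> V' \<longrightarrow> (\<forall>t\<in>{0..1}. jX (H x t) \<in> V)"
        by (rule homotopy_control[OF H(1,4) Vo])
      have wB: "w \<in> B" "\<phi> w \<in> YZ" "w \<in> topspace W" using 2 BY_W by (auto simp: BY_def)
      have "\<phi> w \<in> V'" using wB \<phi>V V'(2) by blast
      then obtain r where r: "r > 0" "dZ.mball (\<phi> w) r \<subseteq> V'"
        using V'(1) dZ(2) dZ.openin_mtopology by metis
      have "openin (subtopology W B) {b \<in> topspace (subtopology W B). \<phi> b \<in> dZ.mball (\<phi> w) (r/2)}"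
        using dZ.openin_mball dZ(2) by (intro openin_continuous_map_preimage[OF \<phi>_cont]) simp
      then obtain R where R: "openin W R"
        "{b \<in> topspace (subtopology W B). \<phi> b \<in> dZ.mball (\<phi> w) (r/2)} = R \<inter> B"
        unfolding openin_subtopology by blast
      have "w \<in> {b \<in> topspace (subtopology W B). \<phi> b \<in> dZ.mball (\<phi> w) (r/2)}"
        using wB(1,3) \<phi>_Z r(1) by simp
      then have "w \<in> R" using R(2) by blast
      then obtain \<rho> where \<rho>: "\<rho> > 0" "dW.mball w \<rho> \<subseteq> R"
        using R(1) dW(2) dW.openin_mtopology by metis
      \<comment> \<open>Each radius is halved for a path through the witness \<open>b\<close>:
        \<open>\<rho>\<close> is shared between \<open>w\<close> to \<open>v\<close> and
        \<open>v\<close> to \<open>b\<close>, and \<open>r\<close> between \<open>\<phi> w\<close>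
        to \<open>\<phi> b\<close> and \<open>\<phi> b\<close> to
        \<open>jX (\<xi> v)\<close>.\<close>
      define \<epsilon> where "\<epsilon> = min (r/2) (\<rho>/2)"
      define U where "U = Q \<inter> (dW.mball w (\<rho>/2) \<inter> {v \<in> topspace W. \<delta> v \<in> {..<\<epsilon>}})"
      have "openin W {v \<in> topspace W. \<delta> v \<in> {..<\<epsilon>}}"
        by (rule openin_continuous_map_preimage[OF \<delta>(1)]) simp
      moreover have "openin W (dW.mball w (\<rho>/2))" using dW.openin_mball dW(2) by simp
      ultimately have "openin (subtopology W Q) U"
        unfolding U_def by (intro openin_subtopology_Int2 openin_Int)
      moreover have "w \<in> U"
        using w 2 wB \<delta>(3) r(1) \<rho>(1) by (auto simp: U_def \<epsilon>_def)
      moreover have "K s v \<in> V" if v: "v \<in> U" for v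
      proof -
        have vW: "v \<in> topspace W" and dwv: "dW w v < \<rho>/2" and dv: "\<delta> v < r/2" "\<delta> v < \<rho>/2"
          and "v \<in> BY \<or> v \<in> F"
          using v by (auto simp: U_def \<epsilon>_def Q_def)
        from this(5) show ?thesis
        proof
          assume vBY: "v \<in> BY"
          have "v \<in> R" using \<rho>(2) dwv vW wB(3) \<rho>(1) by (auto simp: subset_iff)
          then have "\<phi> v \<in> dZ.mball (\<phi> w) (r/2)" using R(2) vBY by (auto simp: BY_def)
          then have "\<phi> v \<in> V'" using r by (auto simp: subset_iff)
          then have "\<phi> v \<in> V" using V'(2) vBY by (auto simp: BY_def)
          then show ?thesis using K_BY[OF vBY] by simp
        next
          assume vF: "v \<in> F"
          then obtain b where b: "b \<in> D" "dW v b < \<delta> v" "dZ (jX (\<xi> v)) (\<phi> b) < \<delta> v"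
            using FN0 by (auto simp: N0_def)
          have bW: "b \<in> topspace W" "b \<in> B" using b(1) DE E_W by (auto simp: D_def)
          have "dW w b < \<rho>"
            using dW.triangle[OF wB(3) vW bW(1)] dwv b(2) dv by linarith
          then have "b \<in> R" using \<rho>(2) wB(3) bW(1) by (auto simp: subset_iff)
          then have "\<phi> b \<in> dZ.mball (\<phi> w) (r/2)" using R(2) bW by auto
          then have "dZ (\<phi> w) (\<phi> b) < r/2" by simp
          moreover have \<xi>v: "\<xi> v \<in> topspace X" using vF FM \<xi>_X by blast
          ultimately have "dZ (\<phi> w) (jX (\<xi> v)) < r"
            using dZ.triangle[OF \<phi>_Z[OF wB(1)] \<phi>_Z[OF bW(2)] jX_Z[OF \<xi>v]] b(3) dv
              dZ.commute[of "\<phi> b" "jX (\<xi> v)"] by linarith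
          then have "jX (\<xi> v) \<in> V'" using r(2) \<phi>_Z[OF wB(1)] jX_Z[OF \<xi>v] by (auto simp: subset_iff)
          then show ?thesis using V'(3) \<xi>v s01[OF vF] K_F[OF vF] by simp
        qed
      qed
      ultimately show ?thesis by blast
    qed
  qed
  have K_act: "K s (actW g w) = actZ g (K s w)"
    if "g \<in> carrier G" "w \<in> Q" "\<And>v. v \<in> F \<Longrightarrow> s v \<in> {0..1}" "s (actW g w) = s w" for s g w
  proof (cases "w \<in> BY")
    case True
    then have "actW g w \<in> BY" using BY_act[OF that(1)] BY_W by blast
    then show ?thesis using True K_BY \<phi>_act[OF that(1)] BY_B(1) by simp
  next
    case False
    then have wF: "w \<in> F" and wW: "w \<in> topspace W" using that(2) Q_W by (auto simp: Q_def)
    have wX: "\<xi> w \<in> topspace X" and wM: "w \<in> M" using wF FM \<xi>_X by auto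
    have s: "s w \<in> {0..1}" using that(3)[OF wF] .
    have "actW g w \<in> F" using F_act[OF that(1) wW] wF by simp
    from K_F[OF this, of s] show ?thesis
      using K_F[OF wF, of s] H(2) that(1,4) wX s \<xi>_act[OF that(1) wM] jX_act[OF that(1) H_X[OF wX s]]
      by simp
  qed

  \<comment> \<open>The region deformed into \<open>YZ\<close> and the extension into
    \<open>Y\<close>\<close>
  define \<nu> where "\<nu> z = (if z \<in> YZ then 1 else \<mu> (iX z))" for z
  \<comment> \<open>The constant 1 on \<open>YZ\<close> matches \<open>\<mu>\<close>, which is 1 on
    \<open>A\<close>, so \<open>\<nu>\<close> is \<open>\<mu>\<close> carried over to
    \<open>Z\<close>.\<close>
  have \<nu>_cont: "continuous_map Z euclideanreal \<nu>"
  proof (rule continuous_map_glue)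
    have "\<mu> x = (\<nu> \<circ> jX) x" if "x \<in> topspace X" for x
      using jX_in_YZ[OF that] iX_jX[of x] \<mu>(3) that by (auto simp: \<nu>_def)
    then show "continuous_map X euclideanreal (\<nu> \<circ> jX)" by (rule continuous_map_eq[OF \<mu>(1)])
    have "continuous_map Y euclideanreal (\<lambda>_. 1)" by simp
    then show "continuous_map Y euclideanreal (\<nu> \<circ> jY)"
      by (rule continuous_map_eq) (simp add: \<nu>_def)
  qed
  \<comment> \<open>Passing through \<open>K\<close> at time 0 yields continuity across
    \<open>BY\<close>, where \<open>\<mu> (\<xi> w)\<close> alone has no meaning.\<close>
  define \<kappa> where "\<kappa> w = \<nu> (K (\<lambda>_. 0) w)" for w
  have \<kappa>_cont: "continuous_map (subtopology W Q) euclideanreal \<kappa>"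
    unfolding \<kappa>_def using continuous_map_compose[OF K_cont \<nu>_cont, of "\<lambda>_. 0"] by (simp add: o_def)
  have \<kappa>_BY: "\<kappa> w = 1" if "w \<in> BY" for w
    using that K_BY by (simp add: \<kappa>_def \<nu>_def BY_def)
  have \<kappa>_F: "\<kappa> w = \<mu> (\<xi> w)" if "w \<in> F" for w
  proof -
    have x: "\<xi> w \<in> topspace X" using that FM \<xi>_X by blast
    then have "K (\<lambda>_. 0) w = jX (\<xi> w)" using K_F[OF that] H(3) by simp
    then show ?thesis
      using jX_in_YZ[OF x] iX_jX[of "\<xi> w"] \<mu>(3) x by (auto simp: \<kappa>_def \<nu>_def)
  qed
  have \<kappa>_act: "\<kappa> (actW g w) = \<kappa> w" if "g \<in> carrier G" "w \<in> Q" for g w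
  proof (cases "w \<in> BY")
    case True then show ?thesis using \<kappa>_BY BY_act that BY_W by auto
  next
    case False
    then have "w \<in> F" using that(2) by (auto simp: Q_def)
    moreover from this have "actW g w \<in> F" using F_act that Q_W by blast
    ultimately show ?thesis using \<kappa>_F \<xi>_act[OF that(1)] \<mu>(2) that(1) FM \<xi>_X by (simp add: subset_iff)
  qed
  \<comment> \<open>Both thresholds are closed: \<open>C\<close> has to be closed to extend a map
    from it, and \<open>P\<close> to leave an open set when removed from \<open>N\<close>. Every
    point of \<open>Q\<close> outside \<open>P\<close> lies in \<open>C\<close>.\<close>
  define C where "C = {w \<in> Q. 1/2 \<le> \<kappa> w}"
  define P where "P = {w \<in> Q. \<kappa> w \<le> 1/2}"
  have CQ: "C \<subseteq> Q" by (auto simp: C_def)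
  have topQ: "topspace (subtopology W Q) = Q" using Q_W by auto
  have C_closed: "closedin W C" and P_closed: "closedin W P"
  proof -
    have "closedin (subtopology W Q) {w \<in> topspace (subtopology W Q). \<kappa> w \<in> {1/2..}}"
      "closedin (subtopology W Q) {w \<in> topspace (subtopology W Q). \<kappa> w \<in> {..1/2}}"
      by (rule closedin_continuous_map_preimage[OF \<kappa>_cont]; simp)+
    then show "closedin W C" "closedin W P"
      unfolding topQ C_def P_def atLeast_iff atMost_iff using Q_closed closedin_trans_full by blast+
  qed
  have C_act: "actW g w \<in> C" if "g \<in> carrier G" "w \<in> C" for g w
    using that \<kappa>_act Q_act Q_W by (auto simp: C_def)
  have C_inv: "G_subset G W actW C"
    unfolding G_subset_iff[OF GW] using CQ Q_W C_act by blast
  have K1_YZ: "K (\<lambda>_. 1) w \<in> YZ" if "w \<in> C" for w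
  proof (cases "w \<in> BY")
    case True then show ?thesis using K_BY by (simp add: BY_def)
  next
    case False
    then have "w \<in> F" "1/2 \<le> \<mu> (\<xi> w)" using that \<kappa>_F by (auto simp: C_def Q_def)
    then have "H (\<xi> w) 1 \<in> A" using \<mu>(4) \<xi>_X FM by blast
    then show ?thesis using K_F[OF \<open>w \<in> F\<close>] jX_in_YZ A_subset by (simp add: subset_iff)
  qed
  \<comment> \<open>On \<open>C\<close> the time-one map lands in \<open>YZ\<close>, so it may be
    read as a map into \<open>Y\<close> and extended there.\<close>
  have "G_map G (subtopology W C) actW Y actY (iY \<circ> K (\<lambda>_. 1))"
    unfolding G_map_def
  proof (intro conjI ballI)
    have "continuous_map (subtopology W C) (subtopology Z YZ) (K (\<lambda>_. 1))"
      using K1_YZ by (intro continuous_map_into_subtopology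
          continuous_map_from_subtopology_mono[OF K_cont CQ]) auto
    then show "continuous_map (subtopology W C) Y (iY \<circ> K (\<lambda>_. 1))"
      by (rule continuous_map_compose[OF _ iY_cont])
    fix g w assume g: "g \<in> carrier G" and "w \<in> topspace (subtopology W C)"
    then have w: "w \<in> C" by simp
    have "K (\<lambda>_. 1) (actW g w) = actZ g (K (\<lambda>_. 1) w)" using w CQ by (intro K_act[OF g]) auto
    then show "(iY \<circ> K (\<lambda>_. 1)) (actW g w) = actY g ((iY \<circ> K (\<lambda>_. 1)) w)"
      using iY_act[OF g K1_YZ[OF w]] by simp
  qed
  then obtain N \<psi> where N: "openin W N" "C \<subseteq> N" "G_subset G W actW N"
    and \<psi>: "G_map G (subtopology W N) actW Y actY \<psi>" "\<forall>w\<in>C. \<psi> w = (iY \<circ> K (\<lambda>_. 1)) w"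
    by (rule G_ANE_extend[OF ANE_Y T W C_closed C_inv])
  have NW: "N \<subseteq> topspace W" using N(1) openin_subset by blast
  have \<psi>_cont: "continuous_map (subtopology W N) Z (\<lambda>w. jY (\<psi> w))"
    using continuous_map_compose[of _ _ \<psi>, OF _ jY_cont] \<psi>(1) by (simp add: G_map_def o_def)
  have \<psi>_C: "jY (\<psi> w) = K (\<lambda>_. 1) w" if "w \<in> C" for w
    using \<psi>(2) that f_inv_into_f[OF K1_YZ[OF that]] by simp
  have \<psi>_Y: "\<psi> w \<in> topspace Y" if "w \<in> N" for w
    using \<psi>(1) that NW unfolding G_map_def continuous_map_def by auto
  have \<psi>_act: "jY (\<psi> (actW g w)) = actZ g (jY (\<psi> w))" if "g \<in> carrier G" "w \<in> N" for g w
    using \<psi>(1) that NW jY_act[OF that(1) \<psi>_Y[OF that(2)]] by (auto simp: G_map_def)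

  \<comment> \<open>Interpolation between \<open>\<phi>\<close> and the map into
    \<open>Y\<close>\<close>
  define s where "s w = 2 * \<tau> w" for w
  \<comment> \<open>Since \<open>\<tau>\<close> is at most \<open>1/2\<close> on \<open>F\<close>,
    the factor 2 gives a time that starts at 0 on \<open>D\<close> and is exactly 1 on
    \<open>F - F0\<close>.\<close>
  have s_cont: "continuous_map (subtopology W F) (top_of_set {0..1}) s"
    unfolding s_def
  proof (intro continuous_map_into_subtopology continuous_intros)
    show "continuous_map (subtopology W F) euclideanreal \<tau>"
      by (rule continuous_map_from_subtopology_mono[OF \<tau>(1) FE])
    show "(\<lambda>w. 2 * \<tau> w) \<in> topspace (subtopology W F) \<rightarrow> {0..1}"
      using \<tau>(2) unfolding topE by (auto simp: F_def)
  qed simp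
  have s01: "s w \<in> {0..1}" if "w \<in> F" for w
    using \<tau>(2) that unfolding topE by (auto simp: F_def s_def)
  \<comment> \<open>\<open>F0\<close> contains \<open>D\<close>, and \<open>N - P\<close> contains
    \<open>BY\<close>, where \<open>\<kappa>\<close> is 1. Off \<open>F0\<close> the set
    \<open>\<Omega>\<close> avoids \<open>P\<close>, so its points in \<open>Q\<close> lie in
    \<open>C\<close>.\<close>
  define \<Omega> where "\<Omega> = F0 \<union> (N - P)"
  define \<Phi> where "\<Phi> w = (if w \<in> Q then K s w else jY (\<psi> w))" for w
  have \<Omega>_open: "openin W \<Omega>"
    unfolding \<Omega>_def by (intro openin_Un F0_open openin_diff N(1) P_closed)
  have \<Omega>W: "\<Omega> \<subseteq> topspace W" using \<Omega>_open openin_subset by blast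
  have B\<Omega>: "B \<subseteq> \<Omega>"
  proof
    fix b assume b: "b \<in> B"
    show "b \<in> \<Omega>"
    proof (cases "b \<in> BY")
      case True
      then have "b \<in> C" "b \<notin> P" using \<kappa>_BY by (auto simp: C_def P_def Q_def)
      then show ?thesis using N(2) by (auto simp: \<Omega>_def)
    next
      case False then show ?thesis using b DF0 by (auto simp: \<Omega>_def D_def)
    qed
  qed
  have \<Omega>_F0: "w \<in> N" "w \<notin> P" if "w \<in> \<Omega> - F0" for w using that by (auto simp: \<Omega>_def)
  \<comment> \<open>Such a point lies in \<open>BY\<close>, where \<open>K\<close> ignores its time,
    or in \<open>F - F0\<close>, where the time is 1. Either way \<open>K s\<close> is the time-one
    map, which \<open>\<psi>\<close> extends from \<open>C\<close>.\<close>
  have agree: "K s w = jY (\<psi> w)" if "w \<in> Q" "w \<in> \<Omega> - F0" for w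
  proof -
    have wC: "w \<in> C" using \<Omega>_F0[OF that(2)] that(1) by (auto simp: C_def P_def)
    have "K s w = K (\<lambda>_. 1) w"
    proof (cases "w \<in> BY")
      case True then show ?thesis by (simp add: K_BY)
    next
      case False
      then have wF: "w \<in> F" using that(1) by (auto simp: Q_def)
      then have "s w = 1" using that(2) by (auto simp: F_def F0_def s_def)
      then show ?thesis using K_F[OF wF] by simp
    qed
    then show ?thesis using \<psi>_C[OF wC] by simp
  qed
  have "continuous_map (subtopology W \<Omega>) Z \<Phi>"
  proof -
    \<comment> \<open>The two closed pieces are \<open>\<Omega> \<inter> Q\<close> and
      \<open>\<Omega> - F0\<close>; they cover \<open>\<Omega>\<close> because \<open>F0\<close>
      lies in \<open>Q\<close>.\<close>
    have "continuous_map (subtopology W \<Omega>) Z (\<lambda>w. if w \<in> \<Omega> \<inter> Q then K s w else jY (\<psi> w))"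
    proof (rule continuous_map_paste_closed)
      show "closedin (subtopology W \<Omega>) (\<Omega> \<inter> Q)"
        by (rule closedin_subtopology_Int_closed[OF Q_closed])
      have "closedin (subtopology W \<Omega>) (\<Omega> \<inter> (topspace W - F0))"
        using F0_open by (intro closedin_subtopology_Int_closed) blast
      moreover have "\<Omega> \<inter> (topspace W - F0) = \<Omega> - F0" using \<Omega>W by blast
      ultimately show "closedin (subtopology W \<Omega>) (\<Omega> - F0)" by simp
      show "topspace (subtopology W \<Omega>) \<subseteq> \<Omega> \<inter> Q \<union> (\<Omega> - F0)" using F0F by (auto simp: Q_def)
      show "continuous_map (subtopology (subtopology W \<Omega>) (\<Omega> \<inter> Q)) Z (K s)"
        unfolding subtopology_subtopology
        by (rule continuous_map_from_subtopology_mono[OF K_cont[OF s_cont]]) blast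
      show "continuous_map (subtopology (subtopology W \<Omega>) (\<Omega> - F0)) Z (\<lambda>w. jY (\<psi> w))"
        unfolding subtopology_subtopology
        by (rule continuous_map_from_subtopology_mono[OF \<psi>_cont]) (use \<Omega>_F0 in blast)
    qed (use agree in blast)
    then show ?thesis by (rule continuous_map_eq) (auto simp: \<Phi>_def)
  qed
  moreover have \<Omega>_act: "actW g w \<in> \<Omega>" if "g \<in> carrier G" "w \<in> \<Omega>" for g w
  proof (cases "w \<in> F0")
    case True then show ?thesis using F_act(2) that \<Omega>W by (auto simp: \<Omega>_def)
  next
    case False
    then have w: "w \<in> N" "w \<notin> P" "w \<in> topspace W" using that \<Omega>W by (auto simp: \<Omega>_def)
    have "actW g w \<in> N" using N(3) G_subset_iff[OF GW] w that(1) by blast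
    moreover have "actW g w \<notin> P"
      using w(2) Q_act[OF that(1) w(3)] \<kappa>_act[OF that(1)] by (auto simp: P_def)
    ultimately show ?thesis by (simp add: \<Omega>_def)
  qed
  moreover have "\<Phi> (actW g w) = actZ g (\<Phi> w)" if "g \<in> carrier G" "w \<in> \<Omega>" for g w
  proof (cases "w \<in> Q")
    case True
    have "K s (actW g w) = actZ g (K s w)"
    \<comment> \<open>Invariance of \<open>s\<close> is known only on \<open>E\<close>, so
      \<open>BY\<close> is treated directly through \<open>\<phi>\<close>.\<close>
    proof (cases "w \<in> BY")
      case False
      then have "w \<in> E" using True FE by (auto simp: Q_def)
      then have "s (actW g w) = s w" using \<tau>(5) that(1) topE by (simp add: s_def)
      then show ?thesis using K_act[OF that(1) True, of s] s01 by blast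
    next
      case True
      then have "actW g w \<in> BY" using BY_act[OF that(1)] BY_W by blast
      then show ?thesis using True K_BY \<phi>_act[OF that(1)] BY_B(1) by simp
    qed
    then show ?thesis using True Q_act[OF that(1)] Q_W by (auto simp: \<Phi>_def)
  next
    case False
    then have "w \<in> N" using that(2) F0F by (auto simp: \<Omega>_def Q_def)
    then show ?thesis using False Q_act[OF that(1)] NW \<psi>_act[OF that(1)] by (auto simp: \<Phi>_def)
  qed
  ultimately have "G_map G (subtopology W \<Omega>) actW Z actZ \<Phi>" by (simp add: G_map_def)
  moreover have "G_subset G W actW \<Omega>"
    unfolding G_subset_iff[OF GW] using \<Omega>W \<Omega>_act by blast
  moreover have "nbhd_of W B \<Omega>" using \<Omega>_open B\<Omega> by (rule nbhd_of_open)
  moreover have "\<Phi> b = \<phi> b" if b: "b \<in> B" for b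
  proof (cases "b \<in> BY")
    case True then show ?thesis using K_BY BQ b by (auto simp: \<Phi>_def)
  next
    case False
    then have bD: "b \<in> D" and bF: "b \<in> F" using b DF0 F0F by (auto simp: D_def)
    have "K s b = jX (H (\<xi> b) 0)" using K_F[OF bF] \<tau>(3) bD by (simp add: s_def)
    also have "\<dots> = \<phi> b" using H(3) \<xi>_X bF FM \<xi>_D[OF bD] by (simp add: subset_iff)
    finally show ?thesis using BQ b by (auto simp: \<Phi>_def)
  qed
  ultimately show "\<exists>U \<Phi>. nbhd_of W B U \<and> G_subset G W actW U \<and>
      G_map G (subtopology W U) actW Z actZ \<Phi> \<and> (\<forall>b\<in>B. \<Phi> b = \<phi> b)" by blast
qed

end

section \<open>The adjunction space\<close>

text \<open>\<open>\<rho>\<close> is a normal form: it sends a point of \<open>A\<close> to its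
  image in \<open>Y\<close> and leaves all else alone. It is constant along the generating pairs,
  and every point is equivalent to its normal form.\<close>

lemma adj_proj_eq_iff:
  defines "\<rho> \<equiv> \<lambda>A (f :: 'x \<Rightarrow> 'y). case_sum (\<lambda>x. if x \<in> A then Inr (f x) else Inl x) Inr"
  shows "adj_proj A f u = adj_proj A f v \<longleftrightarrow> \<rho> A f u = \<rho> A f v"
proof -
  let ?R = "\<lambda>u v. \<exists>a\<in>A. u = Inl a \<and> v = Inr (f a)"
  have 1: "\<rho> A f u = \<rho> A f v" if "equivclp ?R u v" for u v
    using that by (induction rule: equivclp_induct) (auto simp: \<rho>_def)
  have 2: "equivclp ?R u (\<rho> A f u)" for u
    by (cases u) (auto simp: \<rho>_def intro!: r_into_equivclp)
  have "equivclp ?R u v \<longleftrightarrow> \<rho> A f u = \<rho> A f v" for u v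
  proof
    assume "\<rho> A f u = \<rho> A f v"
    with 2[of v] have "equivclp ?R (\<rho> A f u) v" by (simp add: equivclp_sym)
    with 2[of u] show "equivclp ?R u v" by (rule equivclp_trans)
  qed (rule 1)
  then have "adj_proj A f z = {z'. \<rho> A f z = \<rho> A f z'}" for z
    by (simp add: adj_proj_def)
  then show ?thesis by auto
qed

text \<open>The injectivity and disjointness conditions are read off from normal forms, the
  topological ones from the preimages of a set in the two summands.\<close>

lemma G_attachment_adjunction_space:
  assumes G: "group G" and T: "topspace T = carrier G"
    and X: "G_metrizable G T X actX" and Y: "G_metrizable G T Y actY"
    and A: "closedin X A" "G_subset G X actX A"
    and f: "G_map G (subtopology X A) actX Y actY f"
    and Z: "G_metrizable G T (adjunction_space X A f Y) (adj_act actX actY)"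
  shows "G_attachment G T X actX Y actY A f (adjunction_space X A f Y) (adj_act actX actY)
    (\<lambda>x. adj_proj A f (Inl x)) (\<lambda>y. adj_proj A f (Inr y))"
proof -
  interpret group G by fact
  let ?Z = "adjunction_space X A f Y" and ?S = "disjoint_sum X Y"
  have pre: "Inl -` {z \<in> topspace ?S. adj_proj A f z \<in> U} = {x \<in> topspace X. adj_proj A f (Inl x) \<in> U}"
    "Inr -` {z \<in> topspace ?S. adj_proj A f z \<in> U} = {y \<in> topspace Y. adj_proj A f (Inr y) \<in> U}" for U
    by (auto simp: topspace_disjoint_sum)
  have open_iff: "openin ?Z U \<longleftrightarrow> U \<subseteq> topspace ?Z \<and>
      openin X {x \<in> topspace X. adj_proj A f (Inl x) \<in> U} \<and>
      openin Y {y \<in> topspace Y. adj_proj A f (Inr y) \<in> U}" for U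
    by (simp only: openin_adjunction_space topspace_adjunction_space openin_disjoint_sum pre)
  have top: "topspace ?Z = (\<lambda>x. adj_proj A f (Inl x)) ` topspace X \<union> (\<lambda>y. adj_proj A f (Inr y)) ` topspace Y"
    by (auto simp: topspace_adjunction_space topspace_disjoint_sum)
  note act = adj_act_adj_proj[OF G G_metrizable_G_space[OF X] G_metrizable_G_space[OF Y] A(2) f]
  show ?thesis
  proof (unfold_locales)
    show "G_map G X actX ?Z (adj_act actX actY) (\<lambda>x. adj_proj A f (Inl x))"
      unfolding G_map_def continuous_map
    proof (intro conjI allI impI ballI)
      show "(\<lambda>x. adj_proj A f (Inl x)) ` topspace X \<subseteq> topspace ?Z" using top by blast
      show "openin X {x \<in> topspace X. adj_proj A f (Inl x) \<in> U}" if "openin ?Z U" for U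
        using that open_iff by blast
      fix g x assume "g \<in> carrier G" "x \<in> topspace X"
      then show "adj_proj A f (Inl (actX g x)) = adj_act actX actY g (adj_proj A f (Inl x))"
        by (subst act) (auto simp: topspace_disjoint_sum)
    qed
    show "G_map G Y actY ?Z (adj_act actX actY) (\<lambda>y. adj_proj A f (Inr y))"
      unfolding G_map_def continuous_map
    proof (intro conjI allI impI ballI)
      show "(\<lambda>y. adj_proj A f (Inr y)) ` topspace Y \<subseteq> topspace ?Z" using top by blast
      show "openin Y {y \<in> topspace Y. adj_proj A f (Inr y) \<in> U}" if "openin ?Z U" for U
        using that open_iff by blast
      fix g y assume "g \<in> carrier G" "y \<in> topspace Y"
      then show "adj_proj A f (Inr (actY g y)) = adj_act actX actY g (adj_proj A f (Inr y))"
        by (subst act) (auto simp: topspace_disjoint_sum)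
    qed
    show "inj_on (\<lambda>x. adj_proj A f (Inl x)) (topspace X - A)"
      by (auto simp: inj_on_def adj_proj_eq_iff)
    show "inj_on (\<lambda>y. adj_proj A f (Inr y)) (topspace Y)"
      by (auto simp: inj_on_def adj_proj_eq_iff)
    show "openin ?Z U" if "U \<subseteq> topspace ?Z" "openin X {x \<in> topspace X. adj_proj A f (Inl x) \<in> U}"
      "openin Y {y \<in> topspace Y. adj_proj A f (Inr y) \<in> U}" for U
      using that by (simp add: open_iff)
  qed (use T X Y Z A f top in \<open>simp_all add: adj_proj_eq_iff\<close>)
qed

theorem theorem3p2:
  fixes G :: "('g, 'm) monoid_scheme" and T :: "'g topology"
    and X :: "'x topology" and actX :: "'g \<Rightarrow> 'x \<Rightarrow> 'x"
    and Y :: "'y topology" and actY :: "'g \<Rightarrow> 'y \<Rightarrow> 'y"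
    and A :: "'x set" and f :: "'x \<Rightarrow> 'y"
  assumes "lc_Hausdorff_group G T"
    and "G_metrizable G T X actX"
    and "G_metrizable G T Y actY"
    and "closedin X A" and "G_subset G X actX A"
    and "G_map G (subtopology X A) actX Y actY f"
    and "G_ANE TYPE(('x + 'y + 'w) \<times> real) G T X actX"
    and "G_ANE TYPE(('x + 'y + 'w) \<times> real) G T (subtopology X A) actX"
    and "G_ANE TYPE(('x + 'y + 'w) \<times> real) G T Y actY"
    and "G_metrizable G T (adjunction_space X A f Y) (adj_act actX actY)"
  shows "G_ANE TYPE('w) G T (adjunction_space X A f Y) (adj_act actX actY)"
proof -
  interpret tg: topological_group_on G T
    using assms(1) by (simp add: lc_Hausdorff_group_def)
  have T: "topspace T = carrier G" by (rule tg.topspace_group)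
  interpret G_attachment G T X actX Y actY A f "adjunction_space X A f Y" "adj_act actX actY"
    "\<lambda>x. adj_proj A f (Inl x)" "\<lambda>y. adj_proj A f (Inr y)"
    by (rule G_attachment_adjunction_space[OF tg.is_group T assms(2-6,10)])
  \<comment> \<open>One large type contains copies of the cylinder type over \<open>'x\<close>, of
    \<open>'x\<close> itself and of the arbitrary test type \<open>'w\<close>, so
    \<open>G_ANE_inj\<close> yields all four extension properties.\<close>
  have inj_XI: "inj (\<lambda>(x, t). (Inl x, t) :: ('x + 'y + 'w) \<times> real)"
    and inj_X: "inj (\<lambda>x. (Inl x, 0) :: ('x + 'y + 'w) \<times> real)"
    and inj_W: "inj (\<lambda>w. (Inr (Inr w), 0) :: ('x + 'y + 'w) \<times> real)"
    by (auto simp: inj_def)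
  show ?thesis
    by (rule G_ANE_attachment[OF tg.G_ANE_inj[OF T inj_XI assms(7)] tg.G_ANE_inj[OF T inj_X assms(8)]
          tg.G_ANE_inj[OF T inj_W assms(7)] tg.G_ANE_inj[OF T inj_W assms(9)]])
qed

end
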